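(* Let $\Lambda_\infty=(r_0=0,r_1,r_2,\dots)$ be strictly increasing with $\lim_{n\to\infty}r_n=\infty$ and $\sum_{i=1}^\infty 1/r_i=\infty$, and let $0<a<1$. For $m\ge1$ let $D_m=\{\eta_i(t^{r_1},\Lambda_m,[a,1])^{1/r_1}: i=0,\dots,m\}\subset[a,1]$. Then $D_m$ becomes dense in $[a,1]$ as $m\to\infty$, i.e. $$\lim_{m\to\infty}\ \sup_{x\in[a,1]}\ \min_{d\in D_m}|x-d|=0 .$$
   Context: For a sequence $0=r_0<r_1<r_2<\cdots$ of reals, write $\Lambda_n=(r_0,\dots,r_n)$ and $E(\Lambda_n)=\mathrm{span}(t^{r_0}=1,t^{r_1},\dots,t^{r_n})$ (functions on $]0,\infty[$). For an interval $[a,b]$ with $0<a<b$, the Chebyshev–Bernstein basis $(B^n_{0,\Lambda_n},\dots,B^n_{n,\Lambda_n})$ of $E(\Lambda_n)$ over $[a,b]$ is the unique basis of $E(\Lambda_n)$ with $\sum_{k=0}^n B^n_{k,\Lambda_n}\equiv 1$ such that, for each $k$, $B^n_{k,\Lambda_n}$ has a zero of multiplicity (exactly) $k$ at $a$ and of multiplicity $n-k$ at $b$. For $P\in E(\Lambda_n)$ and $m\ge n$, the control points $\eta_i(P,\Lambda_m,[a,b])$, $i=0,\dots,m$, are defined by $P(t)=\sum_{i=0}^m B^m_{i,\Lambda_m}(t)\,\eta_i(P,\Lambda_m,[a,b])$. *)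

theory Defs
  imports "HOL-Analysis.Analysis"
begin

definition in_E :: "(nat \<Rightarrow> real) \<Rightarrow> nat \<Rightarrow> (real \<Rightarrow> real) \<Rightarrow> bool" where
  "in_E r n f \<longleftrightarrow> (\<exists>c. \<forall>t>0. f t = (\<Sum>i\<le>n. c i * t powr r i))"

definition zero_mult :: "(real \<Rightarrow> real) \<Rightarrow> real \<Rightarrow> nat \<Rightarrow> bool" where
  "zero_mult f x k \<longleftrightarrow> (\<forall>j<k. (deriv ^^ j) f x = 0) \<and> (deriv ^^ k) f x \<noteq> 0"

definition is_CB_basis ::
  "(nat \<Rightarrow> real) \<Rightarrow> nat \<Rightarrow> real \<Rightarrow> real \<Rightarrow> (nat \<Rightarrow> real \<Rightarrow> real) \<Rightarrow> bool" where
  "is_CB_basis r n a b B \<longleftrightarrow>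
     (\<forall>k\<le>n. in_E r n (B k)) \<and>
     (\<forall>c. (\<forall>t>0. (\<Sum>k\<le>n. c k * B k t) = 0) \<longrightarrow> (\<forall>k\<le>n. c k = 0)) \<and>
     (\<forall>t>0. (\<Sum>k\<le>n. B k t) = 1) \<and>
     (\<forall>k\<le>n. zero_mult (B k) a k \<and> zero_mult (B k) b (n - k))"

definition control_points ::
  "(nat \<Rightarrow> real) \<Rightarrow> nat \<Rightarrow> real \<Rightarrow> real \<Rightarrow> (real \<Rightarrow> real) \<Rightarrow> real list" where
  "control_points r m a b P = (THE es. length es = Suc m \<and>
     (\<exists>B. is_CB_basis r m a b B \<and> (\<forall>t>0. P t = (\<Sum>i\<le>m. B i t * es ! i))))"

end

theory Submission
  imports Defs "HOL-Computational_Algebra.Polynomial"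
begin

text \<open>
  The Chebyshev--Bernstein basis on \<open>[a,1]\<close> is built by recursion on the dimension: if \<open>B'\<close> is the
  basis for the exponents \<open>r (j + 1) - r 1\<close>, then the tail sums \<open>B k + B (k + 1) + \<dots>\<close> are the
  primitives, vanishing at \<open>a\<close>, of \<open>B' (k - 1)\<close> with respect to \<open>d(t powr r 1)\<close>, scaled to have value 1
  at 1. The scaling factors are the gaps between consecutive control points \<open>\<eta> k\<close> of \<open>t powr r 1\<close>.

  As functions of the left end point \<open>a\<close>, the basis functions obey
  \<open>\<partial>B k = \<kappa> k * B k - \<kappa> (k - 1) * B (k - 1)\<close> and the control points \<open>\<partial>\<eta> k = \<kappa> k * (\<eta> (k + 1) - \<eta> k)\<close>,
  with rates \<open>\<kappa> k \<ge> 0\<close> that do not depend on \<open>t\<close>: run backwards in \<open>a\<close>, this is a pure birth process.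
  Hence \<open>B k \<ge> 0\<close>, and for convex \<open>\<phi>\<close> the sum of the \<open>B k t * \<phi> (\<eta> k)\<close> is nonincreasing in \<open>a\<close>, so that it
  is bounded by its value at \<open>a = 0\<close>. There the control points of \<open>t powr r l\<close> are the products of the
  \<open>1 - r l / r i\<close> over \<open>i > k\<close>. For \<open>\<phi> x = x powr (r 2 / r 1)\<close> the divergence of the sum of the
  \<open>1 / r i\<close> makes \<open>\<phi> (\<eta> k)\<close> uniformly close to the control points of \<open>t powr r 2\<close>, that is, the Jensen
  defect of \<open>\<phi>\<close> for the weights \<open>B k t\<close>, whose mean is \<open>t powr r 1\<close>, tends to 0. By strong
  convexity some \<open>\<eta> k\<close> must be close to \<open>t powr r 1\<close>.
\<close>

section \<open>Recursive construction of the basis\<close>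

definition shift :: "(nat \<Rightarrow> real) \<Rightarrow> nat \<Rightarrow> real" where
  "shift r j = r (Suc j) - r 1"

text \<open>The primitive from \<open>a\<close> to \<open>t\<close>, with respect to \<open>d(s powr r 1)\<close>, of the sum of the
  \<open>c j * s powr shift r j\<close>.\<close>

definition prim :: "(nat \<Rightarrow> real) \<Rightarrow> nat \<Rightarrow> (nat \<Rightarrow> real) \<Rightarrow> real \<Rightarrow> real \<Rightarrow> real" where
  "prim r n c a t = (\<Sum>j\<le>n. c j * (r 1 / r (Suc j)) * (t powr r (Suc j) - a powr r (Suc j)))"

text \<open>Coefficients of the tail sums of the basis. For \<open>k > n + 1\<close> the denominator is 0, and so is the
  quotient; \<open>coef n r a k j = 0\<close> for \<open>k > n\<close> depends on this.\<close>

definition tail_coef ::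
  "(nat \<Rightarrow> real) \<Rightarrow> nat \<Rightarrow> real \<Rightarrow> (nat \<Rightarrow> nat \<Rightarrow> real) \<Rightarrow> nat \<Rightarrow> nat \<Rightarrow> real" where
  "tail_coef r n a c k j =
     (case k of 0 \<Rightarrow> of_bool (j = 0)
      | Suc i \<Rightarrow>
         (case j of 0 \<Rightarrow> - (\<Sum>l\<le>n. c i l * (r 1 / r (Suc l)) * a powr r (Suc l))
          | Suc l \<Rightarrow> c i l * (r 1 / r (Suc l))) / prim r n (c i) a 1)"

primrec coef :: "nat \<Rightarrow> (nat \<Rightarrow> real) \<Rightarrow> real \<Rightarrow> nat \<Rightarrow> nat \<Rightarrow> real" where
  "coef 0 = (\<lambda>r a k j. of_bool (k = 0 \<and> j = 0))"
| "coef (Suc n) = (\<lambda>r a k j. tail_coef r n a (coef n (shift r) a) k j -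
                            tail_coef r n a (coef n (shift r) a) (Suc k) j)"

definition bern :: "nat \<Rightarrow> (nat \<Rightarrow> real) \<Rightarrow> real \<Rightarrow> nat \<Rightarrow> real \<Rightarrow> real" where
  "bern n r a k t = (\<Sum>j\<le>n. coef n r a k j * t powr r j)"

abbreviation tl_coef :: "nat \<Rightarrow> (nat \<Rightarrow> real) \<Rightarrow> real \<Rightarrow> nat \<Rightarrow> nat \<Rightarrow> real" where
  "tl_coef n r a \<equiv> tail_coef r n a (coef n (shift r) a)"

text \<open>Divided by its value \<open>gap n r a k\<close> at 1, this primitive is the tail sum,
  from index \<open>k + 1\<close> on, of the basis functions for the exponents
  \<open>r 0, ..., r (Suc n)\<close>.\<close>

definition bint :: "nat \<Rightarrow> (nat \<Rightarrow> real) \<Rightarrow> real \<Rightarrow> nat \<Rightarrow> real \<Rightarrow> real" where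
  "bint n r a k t = prim r n (coef n (shift r) a k) a t"

abbreviation gap :: "nat \<Rightarrow> (nat \<Rightarrow> real) \<Rightarrow> real \<Rightarrow> nat \<Rightarrow> real" where
  "gap n r a k \<equiv> bint n r a k 1"

definition exps :: "(nat \<Rightarrow> real) \<Rightarrow> bool" where
  "exps r \<longleftrightarrow> r 0 = 0 \<and> strict_mono r"

lemma exps_0: "exps r \<Longrightarrow> r 0 = 0"
  by (simp add: exps_def)

lemma exps_less: "exps r \<Longrightarrow> i < j \<Longrightarrow> r i < r j"
  by (simp add: exps_def strict_mono_def)

lemma exps_pos: "exps r \<Longrightarrow> 0 < j \<Longrightarrow> 0 < r j"
  using exps_less[of r 0 j] by (simp add: exps_0)

lemma exps_pos_Suc: "exps r \<Longrightarrow> 0 < r (Suc j)"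
  by (simp add: exps_pos)

lemma exps_shift: "exps r \<Longrightarrow> exps (shift r)"
  by (auto simp: exps_def shift_def strict_mono_def)

lemma tail_coef_0: "tail_coef r n a c 0 j = of_bool (j = 0)"
  by (simp add: tail_coef_def)

lemma tail_coef_Suc_Suc:
  "tail_coef r n a c (Suc k) (Suc j) = c k j * (r 1 / r (Suc j)) / prim r n (c k) a 1"
  by (simp add: tail_coef_def)

lemma tail_coef_Suc_0:
  "tail_coef r n a c (Suc k) 0 =
    - (\<Sum>l\<le>n. c k l * (r 1 / r (Suc l)) * a powr r (Suc l)) / prim r n (c k) a 1"
  by (simp add: tail_coef_def)

lemma coef_beyond: "n < k \<Longrightarrow> coef n r a k j = 0"
proof (induction n arbitrary: r k j)
  case (Suc n)
  then obtain i where k: "k = Suc i" "n < i" by (cases k) auto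
  show ?case using Suc.IH[of i] Suc.IH[of k] k
    by (auto simp: tail_coef_def split: nat.splits)
qed simp

lemma bint_beyond: "n < k \<Longrightarrow> bint n r a k t = 0"
  by (simp add: bint_def prim_def coef_beyond)

lemma tl_coef_beyond: "Suc n < k \<Longrightarrow> tl_coef n r a k j = 0"
  by (cases k) (auto simp: tail_coef_def coef_beyond split: nat.splits)

lemma abel_sum:
  fixes w :: "nat \<Rightarrow> real"
  shows "(\<Sum>k\<le>n. w k * (S k - S (Suc k))) =
    w 0 * S 0 + (\<Sum>i<n. (w (Suc i) - w i) * S (Suc i)) - w n * S (Suc n)"
  by (induction n) (auto simp: algebra_simps)

text \<open>Summation by parts: the tail of index 0 is the constant 1 and the tail beyond the last
  index vanishes. In this form a linear combination of the basis depends on the increments of its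
  weights, and the recursion acts on the tails directly.\<close>

lemma coef_abel:
  "(\<Sum>k\<le>Suc n. w k * coef (Suc n) r a k j) =
    w 0 * of_bool (j = 0) + (\<Sum>i\<le>n. (w (Suc i) - w i) * tl_coef n r a (Suc i) j)"
proof -
  have "(\<Sum>k\<le>Suc n. w k * coef (Suc n) r a k j) =
    (\<Sum>k\<le>Suc n. w k * (tl_coef n r a k j - tl_coef n r a (Suc k) j))" by simp
  then show ?thesis
    unfolding abel_sum[of w "\<lambda>k. tl_coef n r a k j"]
    by (simp add: tl_coef_beyond tail_coef_0 lessThan_Suc_atMost del: of_bool_eq_iff)
qed

lemma coef_sum: "(\<Sum>k\<le>n. coef n r a k j) = of_bool (j = 0)"
proof (cases n)
  case (Suc m)
  show ?thesis using coef_abel[of "\<lambda>_. 1" m r a j] Suc by simp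
qed simp

lemma bern_sum: assumes "exps r" "0 < t" shows "(\<Sum>k\<le>n. bern n r a k t) = 1"
proof -
  have "(\<Sum>k\<le>n. bern n r a k t) = (\<Sum>j\<le>n. (\<Sum>k\<le>n. coef n r a k j) * t powr r j)"
    unfolding bern_def by (subst sum.swap) (simp add: sum_distrib_right)
  also have "\<dots> = (\<Sum>j\<le>n. (if j = 0 then t powr r 0 else 0))"
    by (intro sum.cong) (auto simp: coef_sum)
  finally show ?thesis using assms by (simp add: exps_0)
qed

text \<open>The gap may be 0, as it is for \<open>k > n\<close>: both sides are then 0 by the
  convention for division. This lets \<open>bern_Suc_Suc\<close> cover the top index as
  well.\<close>

lemma tl_coef_value:
  assumes "exps r" "0 < t"
  shows "(\<Sum>j\<le>Suc n. tl_coef n r a (Suc k) j * t powr r j) = bint n r a k t / gap n r a k"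
proof -
  have "(\<Sum>j\<le>Suc n. tl_coef n r a (Suc k) j * t powr r j) =
     tl_coef n r a (Suc k) 0 + (\<Sum>j\<le>n. tl_coef n r a (Suc k) (Suc j) * t powr r (Suc j))"
    unfolding sum.atMost_Suc_shift using assms by (simp add: exps_0)
  then show ?thesis
    by (simp add: tail_coef_Suc_0 tail_coef_Suc_Suc bint_def prim_def right_diff_distrib
        sum_subtractf diff_divide_distrib sum_divide_distrib)
qed

lemma bern_Suc_0:
  assumes "exps r" "0 < t"
  shows "bern (Suc n) r a 0 t = 1 - bint n r a 0 t / gap n r a 0"
proof -
  have "(\<Sum>j\<le>Suc n. of_bool (j = 0) * t powr r j) = 1"
    unfolding sum.atMost_Suc_shift using assms by (simp add: exps_0)
  then show ?thesis
    by (simp only: bern_def coef.simps left_diff_distrib sum_subtractf tl_coef_value[OF assms] tail_coef_0)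
qed

lemma bern_Suc_Suc:
  assumes "exps r" "0 < t"
  shows "bern (Suc n) r a (Suc k) t =
    bint n r a k t / gap n r a k - bint n r a (Suc k) t / gap n r a (Suc k)"
  by (simp only: bern_def coef.simps left_diff_distrib sum_subtractf tl_coef_value[OF assms])

lemma bint_at_left [simp]: "bint n r a k a = 0"
  by (simp add: bint_def prim_def)

lemma bern_at_left:
  assumes "exps r" "0 < a"
  shows "bern n r a k a = of_bool (k = 0)"
proof (cases n)
  case 0
  then show ?thesis using assms by (auto simp: bern_def exps_0)
next
  case (Suc m)
  then show ?thesis using assms
    by (cases k) (auto simp: bern_Suc_0 bern_Suc_Suc)
qed

lemma bint_deriv:
  assumes r: "exps r" and t: "0 < t"
  shows "((\<lambda>t. bint n r a k t) has_real_derivative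
           bern n (shift r) a k t * (r 1 * t powr (r 1 - 1))) (at t)"
proof -
  have "((\<lambda>t. bint n r a k t) has_real_derivative
     (\<Sum>j\<le>n. coef n (shift r) a k j * (r 1 / r (Suc j)) * (r (Suc j) * t powr (r (Suc j) - 1)))) (at t)"
    unfolding bint_def prim_def using t exps_pos_Suc[OF r, THEN less_imp_neq]
    by (auto intro!: derivative_eq_intros sum.cong)
  also have "(\<Sum>j\<le>n. coef n (shift r) a k j * (r 1 / r (Suc j)) * (r (Suc j) * t powr (r (Suc j) - 1))) =
     bern n (shift r) a k t * (r 1 * t powr (r 1 - 1))"
    unfolding bern_def sum_distrib_right
  proof (intro sum.cong refl)
    fix j assume "j \<in> {..n}"
    have "t powr (r (Suc j) - 1) = t powr shift r j * t powr (r 1 - 1)"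
      by (simp add: shift_def flip: powr_add)
    then show "coef n (shift r) a k j * (r 1 / r (Suc j)) * (r (Suc j) * t powr (r (Suc j) - 1)) =
      coef n (shift r) a k j * t powr shift r j * (r 1 * t powr (r 1 - 1))"
      using exps_pos_Suc[OF r, of j] by simp
  qed
  finally show ?thesis .
qed

section \<open>Dependence on the left end point\<close>

text \<open>The rates are chosen so that the tail sum from index \<open>k + 1\<close> on has
  derivative \<open>- kap k * B k\<close> in \<open>a\<close>. For \<open>k = 0\<close> the
  numerator is the density of \<open>d(t powr r 1)\<close> at the moving lower limit; for
  \<open>k = Suc i\<close> it is what the flow of the shifted exponents carries from the primitive
  \<open>i\<close> into the primitive \<open>k\<close>.\<close>

primrec kap :: "nat \<Rightarrow> (nat \<Rightarrow> real) \<Rightarrow> real \<Rightarrow> nat \<Rightarrow> real" where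
  "kap 0 = (\<lambda>r a k. 0)"
| "kap (Suc n) = (\<lambda>r a k. case k of 0 \<Rightarrow> r 1 * a powr (r 1 - 1) / gap n r a 0
     | Suc i \<Rightarrow> kap n (shift r) a i * gap n r a i / gap n r a (Suc i))"

lemma kap_top: "n \<le> k \<Longrightarrow> kap n r a k = 0"
  by (induction n arbitrary: r k) (auto simp: bint_beyond split: nat.splits)

text \<open>There are two contributions: the flow equation assumed for the shifted exponents, and
  the moving lower limit. The latter is felt for \<open>k = 0\<close> only, because by
  \<open>bern_at_left\<close> the integrand at \<open>a\<close> is 1 for \<open>k = 0\<close> and 0
  otherwise.\<close>

lemma DERIV_bint:
  assumes r: "exps r" and a: "0 < a"
    and D: "\<And>j. ((\<lambda>a. coef n (shift r) a k j) has_real_derivative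
        kap n (shift r) a k * coef n (shift r) a k j -
        (case k of 0 \<Rightarrow> 0 | Suc i \<Rightarrow> kap n (shift r) a i * coef n (shift r) a i j)) (at a)"
  shows "((\<lambda>a. bint n r a k t) has_real_derivative
        kap n (shift r) a k * bint n r a k t -
        (case k of 0 \<Rightarrow> r 1 * a powr (r 1 - 1) | Suc i \<Rightarrow> kap n (shift r) a i * bint n r a i t)) (at a)"
proof -
  let ?c = "coef n (shift r) a"
  let ?w = "\<lambda>j. r 1 / r (Suc j)"
  let ?d = "\<lambda>j. t powr r (Suc j) - a powr r (Suc j)"
  let ?D = "\<lambda>j. kap n (shift r) a k * ?c k j - (case k of 0 \<Rightarrow> 0 | Suc i \<Rightarrow> kap n (shift r) a i * ?c i j)"
  have summand: "((\<lambda>a. f a * w * (p - a powr e)) has_real_derivative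
      f' * w * (p - a powr e) - f a * w * (e * a powr (e - 1))) (at a)"
    if "(f has_real_derivative f') (at a)" for f f' w p e
    using a that by (auto intro!: derivative_eq_intros simp: algebra_simps)
  have "((\<lambda>a. bint n r a k t) has_real_derivative
     (\<Sum>j\<le>n. ?D j * ?w j * ?d j - ?c k j * ?w j * (r (Suc j) * a powr (r (Suc j) - 1)))) (at a)"
    unfolding bint_def prim_def by (intro DERIV_sum summand D)
  also have "(\<Sum>j\<le>n. ?D j * ?w j * ?d j - ?c k j * ?w j * (r (Suc j) * a powr (r (Suc j) - 1))) =
     (\<Sum>j\<le>n. ?D j * ?w j * ?d j) - (\<Sum>j\<le>n. ?c k j * a powr shift r j * (r 1 * a powr (r 1 - 1)))"
    unfolding sum_subtractf
  proof (intro arg_cong2[where f = "(-)"] sum.cong refl)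
    fix j assume "j \<in> {..n}"
    have "a powr (r (Suc j) - 1) = a powr shift r j * a powr (r 1 - 1)"
      by (simp add: shift_def flip: powr_add)
    then show "?c k j * ?w j * (r (Suc j) * a powr (r (Suc j) - 1)) =
      ?c k j * a powr shift r j * (r 1 * a powr (r 1 - 1))"
      using exps_pos_Suc[OF r, of j] by simp
  qed
  also have "(\<Sum>j\<le>n. ?c k j * a powr shift r j * (r 1 * a powr (r 1 - 1))) =
      of_bool (k = 0) * (r 1 * a powr (r 1 - 1))"
    using bern_at_left[OF exps_shift[OF r] a, of n k]
    by (simp add: bern_def flip: sum_distrib_right)
  also have "(\<Sum>j\<le>n. ?D j * ?w j * ?d j) =
     kap n (shift r) a k * bint n r a k t -
     (case k of 0 \<Rightarrow> 0 | Suc i \<Rightarrow> kap n (shift r) a i * bint n r a i t)"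
    by (cases k) (simp_all add: bint_def prim_def left_diff_distrib sum_subtractf
        diff_divide_distrib sum_distrib_left mult.assoc)
  finally show ?thesis by (cases k) simp_all
qed

lemma tl_coef_Suc_0:
  assumes r: "exps r" and g: "gap n r a k \<noteq> 0"
  shows "tl_coef n r a (Suc k) 0 = 1 - (\<Sum>j\<le>n. tl_coef n r a (Suc k) (Suc j))"
proof -
  have "(\<Sum>j\<le>Suc n. tl_coef n r a (Suc k) j) = 1"
    using tl_coef_value[OF r, of 1 n a k] g by simp
  then show ?thesis unfolding sum.atMost_Suc_shift by simp
qed

text \<open>Quotient rule. The rate \<open>kap n (shift r) a k\<close> scales numerator and
  denominator alike and cancels; what remains is the inflow from index \<open>k - 1\<close>, or from
  the moving end point if \<open>k = 0\<close>.\<close>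

lemma DERIV_tl_coef:
  assumes r: "exps r" and a: "0 < a" "a < 1"
    and g: "\<And>k a. k \<le> n \<Longrightarrow> 0 < a \<Longrightarrow> a < 1 \<Longrightarrow> 0 < gap n r a k"
    and D: "\<And>k j. ((\<lambda>a. coef n (shift r) a k j) has_real_derivative
        kap n (shift r) a k * coef n (shift r) a k j -
        (case k of 0 \<Rightarrow> 0 | Suc i \<Rightarrow> kap n (shift r) a i * coef n (shift r) a i j)) (at a)"
  shows "((\<lambda>a. tl_coef n r a (Suc k) j) has_real_derivative
        - kap (Suc n) r a k * (tl_coef n r a k j - tl_coef n r a (Suc k) j)) (at a)"
proof (cases "k \<le> n")
  case False
  then show ?thesis using kap_top[of "Suc n" k r a]
    by (simp add: tl_coef_beyond not_le Suc_leI del: kap.simps)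
next
  case k: True
  have S: "((\<lambda>a. tl_coef n r a (Suc k) (Suc j)) has_real_derivative
        - kap (Suc n) r a k * (tl_coef n r a k (Suc j) - tl_coef n r a (Suc k) (Suc j))) (at a)" for j
  proof -
    have g0: "gap n r a k \<noteq> 0" using g[OF k a] by simp
    have "((\<lambda>a. coef n (shift r) a k j * (r 1 / r (Suc j)) / gap n r a k) has_real_derivative
      - kap (Suc n) r a k * (tl_coef n r a k (Suc j) - tl_coef n r a (Suc k) (Suc j))) (at a)"
    proof (rule DERIV_cong[OF DERIV_divide[OF DERIV_cmult_right[OF D] DERIV_bint[OF r a(1) D] g0]])
      show "((kap n (shift r) a k * coef n (shift r) a k j -
          (case k of 0 \<Rightarrow> 0 | Suc i \<Rightarrow> kap n (shift r) a i * coef n (shift r) a i j)) * (r 1 / r (Suc j)) *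
          gap n r a k - coef n (shift r) a k j * (r 1 / r (Suc j)) *
          (kap n (shift r) a k * gap n r a k -
          (case k of 0 \<Rightarrow> r 1 * a powr (r 1 - 1) | Suc i \<Rightarrow> kap n (shift r) a i * gap n r a i))) /
          (gap n r a k * gap n r a k) =
        - kap (Suc n) r a k * (tl_coef n r a k (Suc j) - tl_coef n r a (Suc k) (Suc j))"
      proof (cases k)
        case 0
        have "((K * c - 0) * w * h - c * w * (K * h - p)) / (h * h) = - (p / h) * (0 - c * w / h)"
          if "h \<noteq> 0" for K c w h p :: real
          using that by (simp add: field_simps)
        note quot = this
        have zero: "tl_coef n r a 0 (Suc j) = 0" by (simp add: tail_coef_0)
        show ?thesis unfolding kap.simps tail_coef_Suc_Suc 0 nat.case bint_def[symmetric] zero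
          by (rule quot[OF g0[unfolded 0]])
      next
        case (Suc i)
        then have g1: "gap n r a i \<noteq> 0" using g[of i a] k a by simp
        have "((K * c - L * d) * w * h - c * w * (K * h - L * h')) / (h * h) =
            - (L * h' / h) * (d * w / h' - c * w / h)"
          if "h \<noteq> 0" "h' \<noteq> 0" for K c w h L d h' :: real
          using that by (simp add: field_simps)
        note quot = this
        show ?thesis unfolding kap.simps tail_coef_Suc_Suc Suc nat.case bint_def[symmetric]
          by (rule quot[OF g0[unfolded Suc] g1])
      qed
    qed
    then show ?thesis by (simp add: tail_coef_Suc_Suc bint_def)
  qed
  show ?thesis
  proof (cases j)
    case (Suc i)
    then show ?thesis using S by simp
  next
    case 0
    \<comment> \<open>The constant coefficient is recovered from the others, since the tail has
      value 1 at \<open>t = 1\<close>. This relation needs a nonzero gap, hence the transfer on the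
      open unit interval below.\<close>
    have "((\<lambda>a. 1 - (\<Sum>j\<le>n. tl_coef n r a (Suc k) (Suc j))) has_real_derivative
      0 - (\<Sum>j\<le>n. - kap (Suc n) r a k * (tl_coef n r a k (Suc j) - tl_coef n r a (Suc k) (Suc j)))) (at a)"
      by (intro derivative_intros S)
    also have "0 - (\<Sum>j\<le>n. - kap (Suc n) r a k * (tl_coef n r a k (Suc j) - tl_coef n r a (Suc k) (Suc j))) =
      kap (Suc n) r a k * ((\<Sum>j\<le>n. tl_coef n r a k (Suc j)) - (\<Sum>j\<le>n. tl_coef n r a (Suc k) (Suc j)))"
      by (simp add: sum_negf sum_distrib_left right_diff_distrib sum_subtractf del: kap.simps)
    also have "(\<Sum>j\<le>n. tl_coef n r a k (Suc j)) = 1 - tl_coef n r a k 0"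
    proof (cases k)
      case (Suc i)
      then have "gap n r a i \<noteq> 0" using g[of i a] a k by simp
      from tl_coef_Suc_0[OF r this] show ?thesis using Suc by simp
    qed (simp add: tail_coef_0)
    also have "(\<Sum>j\<le>n. tl_coef n r a (Suc k) (Suc j)) = 1 - tl_coef n r a (Suc k) 0"
      using tl_coef_Suc_0[OF r, of n a k] g[OF k a] by simp
    finally have *: "((\<lambda>a. 1 - (\<Sum>j\<le>n. tl_coef n r a (Suc k) (Suc j))) has_real_derivative
      - kap (Suc n) r a k * (tl_coef n r a k 0 - tl_coef n r a (Suc k) 0)) (at a)"
      by (simp add: algebra_simps del: kap.simps)
    have "((\<lambda>a. tl_coef n r a (Suc k) 0) has_real_derivative
      - kap (Suc n) r a k * (tl_coef n r a k 0 - tl_coef n r a (Suc k) 0)) (at a)"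
    proof (rule has_field_derivative_transform_within_open[OF *])
      fix x assume "x \<in> {0<..<1::real}"
      then show "1 - (\<Sum>j\<le>n. tl_coef n r x (Suc k) (Suc j)) = tl_coef n r x (Suc k) 0"
        using tl_coef_Suc_0[OF r, of n x k] g[OF k, of x] by simp
    qed (use a in auto)
    then show ?thesis using 0 by simp
  qed
qed

section \<open>Positivity of the basis functions\<close>

lemma bint_mono:
  assumes r: "exps r" and a: "0 < a"
    and pos: "\<And>t. a < t \<Longrightarrow> t < 1 \<Longrightarrow> 0 < bern n (shift r) a k t"
    and st: "a \<le> s" "s < t" "t \<le> 1"
  shows "bint n r a k s < bint n r a k t"
proof (rule DERIV_pos_imp_increasing_open[OF st(2)])
  fix x assume x: "s < x" "x < t"
  show "\<exists>y. ((\<lambda>t. bint n r a k t) has_real_derivative y) (at x) \<and> 0 < y"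
  proof (intro exI conjI)
    show "((\<lambda>t. bint n r a k t) has_real_derivative
      bern n (shift r) a k x * (r 1 * x powr (r 1 - 1))) (at x)"
      using x st a by (intro bint_deriv r) auto
    show "0 < bern n (shift r) a k x * (r 1 * x powr (r 1 - 1))"
      using x st a exps_pos[OF r, of 1] by (intro mult_pos_pos pos) auto
  qed
next
  show "continuous_on {s..t} (\<lambda>t. bint n r a k t)"
    using st a
    by (intro continuous_at_imp_continuous_on ballI DERIV_isCont[OF bint_deriv[OF r]]) auto
qed

text \<open>The three properties go through one induction: positive basis functions in dimension
  \<open>n\<close> make the gaps positive, these give the flow equation and positive rates for
  \<open>Suc n\<close>, and from those follows positivity of the basis functions for
  \<open>Suc n\<close>.\<close>

definition flow :: "nat \<Rightarrow> bool" where
  "flow n \<longleftrightarrow> (\<forall>r a. exps r \<longrightarrow> 0 < a \<longrightarrow> a < 1 \<longrightarrow>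
     (\<forall>k j. ((\<lambda>a. coef n r a k j) has_real_derivative
        kap n r a k * coef n r a k j -
        (case k of 0 \<Rightarrow> 0 | Suc i \<Rightarrow> kap n r a i * coef n r a i j)) (at a)) \<and>
     (\<forall>k<n. 0 < kap n r a k) \<and>
     (\<forall>k\<le>n. \<forall>t. a < t \<longrightarrow> t < 1 \<longrightarrow> 0 < bern n r a k t))"

lemma flow_gap_pos:
  assumes "flow n" "exps r" "0 < a" "a < 1" "k \<le> n"
  shows "0 < gap n r a k"
  using bint_mono[of r a n k a 1] assms exps_shift[of r] by (auto simp: flow_def)

lemma DERIV_bern:
  assumes D: "\<And>j. ((\<lambda>a. coef n r a k j) has_real_derivative
        kap n r a k * coef n r a k j -
        (case k of 0 \<Rightarrow> 0 | Suc i \<Rightarrow> kap n r a i * coef n r a i j)) (at a)"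
  shows "((\<lambda>a. bern n r a k t) has_real_derivative
        kap n r a k * bern n r a k t -
        (case k of 0 \<Rightarrow> 0 | Suc i \<Rightarrow> kap n r a i * bern n r a i t)) (at a)"
proof -
  have "((\<lambda>a. bern n r a k t) has_real_derivative
     (\<Sum>j\<le>n. (kap n r a k * coef n r a k j -
        (case k of 0 \<Rightarrow> 0 | Suc i \<Rightarrow> kap n r a i * coef n r a i j)) * t powr r j)) (at a)"
    unfolding bern_def by (intro DERIV_sum DERIV_cmult_right D)
  also have "(\<Sum>j\<le>n. (kap n r a k * coef n r a k j -
        (case k of 0 \<Rightarrow> 0 | Suc i \<Rightarrow> kap n r a i * coef n r a i j)) * t powr r j) =
     kap n r a k * bern n r a k t -
        (case k of 0 \<Rightarrow> 0 | Suc i \<Rightarrow> kap n r a i * bern n r a i t)"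
    by (cases k) (simp_all add: bern_def left_diff_distrib sum_subtractf sum_distrib_left mult.assoc)
  finally show ?thesis .
qed

text \<open>A minimum of \<open>h\<close> over \<open>[s,t]\<close> with a nonpositive value could be taken before \<open>t\<close>, where \<open>h\<close>
  still decreases.\<close>

lemma pos_of_decreasing_at_nonpos:
  fixes h h' :: "real \<Rightarrow> real"
  assumes "s < t" "0 \<le> h t"
    and D: "\<And>x. s \<le> x \<Longrightarrow> x \<le> t \<Longrightarrow> (h has_real_derivative h' x) (at x)"
    and neg: "\<And>x. s \<le> x \<Longrightarrow> x < t \<Longrightarrow> h x \<le> 0 \<Longrightarrow> h' x < 0"
  shows "0 < h s"
proof (rule ccontr)
  assume hs: "\<not> 0 < h s"
  have "continuous_on {s..t} h"
    by (meson D DERIV_isCont atLeastAtMost_iff continuous_at_imp_continuous_on)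
  then obtain m where m: "m \<in> {s..t}" "\<And>x. x \<in> {s..t} \<Longrightarrow> h m \<le> h x"
    using continuous_attains_inf[of "{s..t}" h] assms(1) by auto
  obtain m' where m': "m' \<in> {s..t}" "\<And>x. x \<in> {s..t} \<Longrightarrow> h m' \<le> h x" "m' < t"
  proof (cases "m = t")
    case True
    then show ?thesis using that[of s] m hs assms(1,2) by force
  qed (use m that[of m] in auto)
  have "h m' \<le> 0" using m'(2)[of s] hs assms(1) by simp
  then have "h' m' < 0" using neg m' by simp
  from DERIV_neg_dec_right[OF D this] m' obtain d where
    d: "d > 0" "\<And>e. 0 < e \<Longrightarrow> e < d \<Longrightarrow> h (m' + e) < h m'" by auto
  define e where "e = min (d / 2) (t - m')"
  have "0 < e" "e < d" "m' + e \<in> {s..t}"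
    using d m' by (auto simp: e_def min_def)
  then show False using d(2)[of e] m'(2)[of "m' + e"] by simp
qed

lemma flow: "flow n"
proof (induction n)
  case 0
  show ?case by (auto simp: flow_def bern_def exps_0 split: nat.splits)
next
  case (Suc n)
  have gp: "0 < gap n r a k" if "exps r" "0 < a" "a < 1" "k \<le> n" for r a k
    using flow_gap_pos[OF Suc] that .
  have D: "((\<lambda>a. coef (Suc n) r a k j) has_real_derivative
        kap (Suc n) r a k * coef (Suc n) r a k j -
        (case k of 0 \<Rightarrow> 0 | Suc i \<Rightarrow> kap (Suc n) r a i * coef (Suc n) r a i j)) (at a)"
    if r: "exps r" and a: "0 < a" "a < 1" for r a k j
  proof -
    have T: "((\<lambda>a. tl_coef n r a (Suc k) j) has_real_derivative
        - kap (Suc n) r a k * (tl_coef n r a k j - tl_coef n r a (Suc k) j)) (at a)" for k j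
      using gp[OF r] Suc exps_shift[OF r] a
      by (intro DERIV_tl_coef r a) (auto simp: flow_def)
    show ?thesis
    proof (cases k)
      case 0
      have "((\<lambda>a. 1 * of_bool (j = 0) - tl_coef n r a (Suc k) j) has_real_derivative
        0 - - kap (Suc n) r a k * (tl_coef n r a k j - tl_coef n r a (Suc k) j)) (at a)"
        by (intro derivative_intros T)
      then show ?thesis using 0 by (simp add: tail_coef_0 del: kap.simps)
    next
      case (Suc i)
      have "((\<lambda>a. tl_coef n r a (Suc i) j - tl_coef n r a (Suc k) j) has_real_derivative
        - kap (Suc n) r a i * (tl_coef n r a i j - tl_coef n r a (Suc i) j)
        - - kap (Suc n) r a k * (tl_coef n r a k j - tl_coef n r a (Suc k) j)) (at a)"
        by (intro derivative_intros T)
      then show ?thesis using Suc by (simp del: kap.simps)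
    qed
  qed
  have K: "0 < kap (Suc n) r a k" if r: "exps r" and a: "0 < a" "a < 1" and k: "k < Suc n" for r a k
  proof (cases k)
    case 0
    then show ?thesis using gp[OF r a, of 0] exps_pos[OF r, of 1] a by simp
  next
    case (Suc i)
    then have "0 < kap n (shift r) a i"
      using Suc.IH exps_shift[OF r] a k by (auto simp: flow_def)
    then show ?thesis using Suc gp[OF r a, of i] gp[OF r a, of k] k by simp
  qed
  \<comment> \<open>Here \<open>t\<close> is fixed and the left end point moves. For index
    \<open>Suc k\<close> the value is 0 once the end point reaches \<open>t\<close>. Wherever the
    value is nonpositive, the derivative is negative, because the outflow \<open>kap k * B k\<close>
    from the previous index is positive by the induction on \<open>k\<close>. So
    \<open>pos_of_decreasing_at_nonpos\<close> applies.\<close>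
  have P: "\<forall>a. 0 < a \<longrightarrow> a < t \<longrightarrow> 0 < bern (Suc n) r a k t"
    if r: "exps r" and t: "t < 1" and k: "k \<le> Suc n" for r k t
    using k
  proof (induction k)
    case 0
    show ?case
    proof (intro allI impI)
      fix a assume a: "0 < a" "a < t"
      have "bint n r a 0 t < gap n r a 0"
        using Suc.IH exps_shift[OF r] a t by (intro bint_mono r a(1)) (auto simp: flow_def)
      then show "0 < bern (Suc n) r a 0 t"
        using gp[OF r a(1), of 0] a t by (simp add: bern_Suc_0[OF r])
    qed
  next
    case (Suc k)
    show ?case
    proof (intro allI impI)
      fix a assume a: "0 < a" "a < t"
      show "0 < bern (Suc n) r a (Suc k) t"
      proof (rule pos_of_decreasing_at_nonpos[OF a(2)])
        show "0 \<le> bern (Suc n) r t (Suc k) t" using bern_at_left[OF r] a by simp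
      next
        fix x assume x: "a \<le> x" "x \<le> t"
        show "((\<lambda>a. bern (Suc n) r a (Suc k) t) has_real_derivative
          kap (Suc n) r x (Suc k) * bern (Suc n) r x (Suc k) t -
          kap (Suc n) r x k * bern (Suc n) r x k t) (at x)"
          using DERIV_bern[OF D[OF r], of x "Suc k" t] x a t by (simp del: kap.simps)
      next
        fix x assume x: "a \<le> x" "x < t" "bern (Suc n) r x (Suc k) t \<le> 0"
        have "0 \<le> kap (Suc n) r x (Suc k)"
          using K[OF r, of x "Suc k"] kap_top[of "Suc n" "Suc k"] x a t
          by (cases "Suc k < Suc n") (auto simp del: kap.simps)
        then have "kap (Suc n) r x (Suc k) * bern (Suc n) r x (Suc k) t \<le> 0"
          using x by (simp add: mult_nonneg_nonpos del: kap.simps)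
        moreover have "0 < kap (Suc n) r x k * bern (Suc n) r x k t"
          using K[OF r, of x k] Suc x a t by (simp del: kap.simps)
        ultimately show "kap (Suc n) r x (Suc k) * bern (Suc n) r x (Suc k) t -
          kap (Suc n) r x k * bern (Suc n) r x k t < 0" by linarith
      qed
    qed
  qed
  show ?case unfolding flow_def
    by (intro allI impI conjI D K P[rule_format]) auto
qed

section \<open>The left end point 0\<close>

lemma prod_shift_bounds:
  fixes f :: "nat \<Rightarrow> real"
  shows "(\<Prod>i=k..n. f (Suc i)) = (\<Prod>i=Suc k..Suc n. f i)"
  by (rule prod.shift_bounds_cl_Suc_ivl[symmetric])

lemma shift_add: "shift r j + (r 1 + y) = r (Suc j) + y"
  by (simp add: shift_def)

lemma prod_shift: "(\<Prod>i=k..n. shift r i) = (\<Prod>i=Suc k..Suc n. r i - r 1)"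
  unfolding shift_def by (rule prod_shift_bounds)

lemma exps_prod_pos: "exps r \<Longrightarrow> 0 < (\<Prod>i=Suc k..n. r i)"
  by (intro prod_pos) (auto intro: exps_pos)

lemma exps_prod_diff_pos: "exps r \<Longrightarrow> 0 < (\<Prod>i=Suc (Suc k)..n. r i - r 1)"
  by (intro prod_pos) (auto intro: exps_less)

lemma gap_zero_sum:
  assumes "exps r"
  shows "gap n r 0 k = r 1 * (\<Sum>j\<le>n. coef n (shift r) 0 k j / r (Suc j))"
  unfolding bint_def prim_def sum_distrib_left
  using exps_pos_Suc[OF assms] by (intro sum.cong) auto

text \<open>The left-hand side is the integral of \<open>B k t * t powr (x - 1)\<close> over \<open>[0,1]\<close>.\<close>

lemma coef_zero_moment:
  assumes "exps r" "k \<le> n" "0 < x"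
  shows "(\<Sum>j\<le>n. coef n r 0 k j / (r j + x)) = (\<Prod>i=Suc k..n. r i) / (\<Prod>i=k..n. r i + x)"
  using assms
proof (induction n arbitrary: r k x)
  case 0
  then show ?case by simp
next
  case (Suc n)
  let ?r = "shift r"
  have r0: "r 0 = 0" and r1: "0 < r 1" and rp: "\<And>j. 0 < r (Suc j)"
    using Suc.prems exps_pos by (auto simp: exps_0)
  have nz: "r i \<noteq> 0" "r i + x \<noteq> 0" if "0 < i" for i
    using that exps_pos[OF Suc.prems(1) that] Suc.prems(3) by auto
  have pnz: "(\<Prod>i=Suc k..m. r i) \<noteq> 0" "(\<Prod>i=Suc k..m. r i + x) \<noteq> 0" for k m
    using nz by auto
  have dnz: "(\<Prod>i=Suc (Suc k)..m. r i - r 1) \<noteq> 0" for k m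
    using exps_prod_diff_pos[OF Suc.prems(1)] by (metis less_irrefl)
  have mom: "(\<Sum>j\<le>n. coef n ?r 0 k j / (r (Suc j) + y)) =
      (\<Prod>i=Suc (Suc k)..Suc n. r i - r 1) / (\<Prod>i=Suc k..Suc n. r i + y)"
    if "k \<le> n" "0 \<le> y" for k y
  proof -
    have "(\<Sum>j\<le>n. coef n ?r 0 k j / (?r j + (r 1 + y))) =
       (\<Prod>i=Suc k..n. ?r i) / (\<Prod>i=k..n. ?r i + (r 1 + y))"
      using Suc.IH[OF exps_shift[OF Suc.prems(1)] that(1), of "r 1 + y"] r1 that by simp
    then show ?thesis
      by (simp only: prod_shift shift_add prod_shift_bounds[of "\<lambda>i. r i + y"])
  qed
  have g: "gap n r 0 k = r 1 * ((\<Prod>i=Suc (Suc k)..Suc n. r i - r 1) / (\<Prod>i=Suc k..Suc n. r i))"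
    if "k \<le> n" for k
    using mom[OF that, of 0] unfolding gap_zero_sum[OF Suc.prems(1)] by (simp only: add_0_right)
  have T: "(\<Sum>j\<le>Suc n. tl_coef n r 0 (Suc k) j / (r j + x)) =
      (1 - (\<Prod>i=Suc k..Suc n. r i) / (\<Prod>i=Suc k..Suc n. r i + x)) / x" if "k \<le> n" for k
  proof -
    let ?c = "coef n ?r 0 k"
    have "(\<Sum>j\<le>Suc n. tl_coef n r 0 (Suc k) j / (r j + x)) =
      (\<Sum>j\<le>n. ?c j * (r 1 / r (Suc j)) / gap n r 0 k / (r (Suc j) + x))"
      unfolding sum.atMost_Suc_shift
      using rp by (simp add: tail_coef_Suc_0 tail_coef_Suc_Suc bint_def)
    \<comment> \<open>Partial fractions,
      \<open>1 / (p * (p + x)) = (1 / p - 1 / (p + x)) / x\<close>, reduce the moment of a tail to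
      \<open>mom\<close> at 0 and at \<open>x\<close>.\<close>
    also have "\<dots> = (\<Sum>j\<le>n. r 1 / (gap n r 0 k * x) * (?c j / (r (Suc j) + 0) - ?c j / (r (Suc j) + x)))"
    proof (intro sum.cong refl)
      fix j
      have "c * (s / p) / h / (p + x) = s / (h * x) * (c / (p + 0) - c / (p + x))"
        if "p \<noteq> 0" "p + x \<noteq> 0" for c s p h :: real
        using that Suc.prems(3) by (simp add: field_simps)
      then show "?c j * (r 1 / r (Suc j)) / gap n r 0 k / (r (Suc j) + x) =
        r 1 / (gap n r 0 k * x) * (?c j / (r (Suc j) + 0) - ?c j / (r (Suc j) + x))"
        using nz[of "Suc j"] by blast
    qed
    also have "\<dots> = r 1 / (gap n r 0 k * x) *
       ((\<Prod>i=Suc (Suc k)..Suc n. r i - r 1) / (\<Prod>i=Suc k..Suc n. r i + 0) -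
        (\<Prod>i=Suc (Suc k)..Suc n. r i - r 1) / (\<Prod>i=Suc k..Suc n. r i + x))"
      unfolding sum_distrib_left[symmetric] sum_subtractf
      using mom[OF that, of 0] mom[OF that, of x] Suc.prems(3) by (simp only: less_imp_le order_refl)
    also have "\<dots> = (1 - (\<Prod>i=Suc k..Suc n. r i) / (\<Prod>i=Suc k..Suc n. r i + x)) / x"
    proof -
      have "s / (s * (D / R) * x) * (D / R - D / X) = (1 - R / X) / x"
        if "s \<noteq> 0" "D \<noteq> 0" "R \<noteq> 0" "X \<noteq> 0" for s D R X :: real
        using that Suc.prems(3) by (simp add: field_simps)
      from this[OF _ dnz pnz(1) pnz(2)] show ?thesis unfolding g[OF that] add_0_right
        using r1 by (metis less_irrefl)
    qed
    finally show ?thesis .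
  qed
  have step: "(\<Prod>i=k..Suc n. f i) = f k * (\<Prod>i=Suc k..Suc n. f i)" if "k \<le> Suc n" for k and f :: "nat \<Rightarrow> real"
    using that by (rule prod.atLeast_Suc_atMost)
  let ?R = "\<lambda>k. \<Prod>i=k..Suc n. r i" and ?X = "\<lambda>k. \<Prod>i=k..Suc n. r i + x"
  have T': "(\<Sum>j\<le>Suc n. tl_coef n r 0 k j / (r j + x)) = (1 - ?R k / ?X k) / x" if "k \<le> Suc n" for k
  proof (cases k)
    case 0
    \<comment> \<open>The product contains the factor \<open>r 0 = 0\<close>, so the same formula
      gives the moment \<open>1 / x\<close> of the tail of index 0, which is constant.\<close>
    have "?R 0 = 0" using r0 by auto
    then show ?thesis unfolding 0 sum.atMost_Suc_shift using r0 by (simp add: tail_coef_0)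
  next
    case (Suc i)
    then show ?thesis using T[of i] that by simp
  qed
  have T'': "(\<Sum>j\<le>Suc n. tl_coef n r 0 (Suc k) j / (r j + x)) = (1 - ?R (Suc k) / ?X (Suc k)) / x"
    using T'[of "Suc k"] Suc.prems(2)
    by (cases "k = Suc n") (auto simp: tl_coef_beyond)
  have "(\<Sum>j\<le>Suc n. coef (Suc n) r 0 k j / (r j + x)) =
      (1 - ?R k / ?X k) / x - (1 - ?R (Suc k) / ?X (Suc k)) / x"
    by (simp only: coef.simps diff_divide_distrib[of "tl_coef _ _ _ _ _"] sum_subtractf T'[OF Suc.prems(2)] T'')
  also have "\<dots> = ?R (Suc k) / ?X k"
  proof -
    have "(1 - (Y - x) * R / (Y * X)) / x - (1 - R / X) / x = R / (Y * X)"
      if "Y \<noteq> 0" "X \<noteq> 0" for R X Y :: real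
      using that Suc.prems(3) by (simp add: field_simps)
    from this[of "r k + x"] have "(1 - r k * R / ((r k + x) * X)) / x - (1 - R / X) / x = R / ((r k + x) * X)"
      if "r k + x \<noteq> 0" "X \<noteq> 0" for R X :: real
      using that by simp
    moreover have "r k + x \<noteq> 0" using nz(2)[of k] r0 Suc.prems(3) by (cases "k = 0") auto
    ultimately show ?thesis using pnz(2)[of k "Suc n"] unfolding step[OF Suc.prems(2)] by blast
  qed
  finally show ?case .
qed

text \<open>The gap is \<open>r 1\<close> times the moment at \<open>x = r 1\<close> of the basis
  function \<open>k\<close> for the shifted exponents.\<close>

lemma gap_zero:
  assumes r: "exps r" and k: "k \<le> n"
  shows "gap n r 0 k = r 1 * ((\<Prod>i=Suc (Suc k)..Suc n. r i - r 1) / (\<Prod>i=Suc k..Suc n. r i))"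
proof -
  have r1: "0 < r 1" and rp: "\<And>j. 0 < r (Suc j)" using r exps_pos by auto
  have "(\<Sum>j\<le>n. coef n (shift r) 0 k j / (shift r j + (r 1 + 0))) =
       (\<Prod>i=Suc k..n. shift r i) / (\<Prod>i=k..n. shift r i + (r 1 + 0))"
    using coef_zero_moment[OF exps_shift[OF r] k, of "r 1"] r1 by simp
  then have "(\<Sum>j\<le>n. coef n (shift r) 0 k j / r (Suc j)) =
       (\<Prod>i=Suc (Suc k)..Suc n. r i - r 1) / (\<Prod>i=Suc k..Suc n. r i)"
    by (simp only: prod_shift shift_add prod_shift_bounds[of "\<lambda>i. r i + 0"]) (simp only: add_0_right)
  then show ?thesis unfolding gap_zero_sum[OF r] by (simp only:)
qed

lemma gap_zero_pos:
  assumes r: "exps r" and k: "k \<le> n"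
  shows "0 < gap n r 0 k"
  unfolding gap_zero[OF assms] using exps_pos[OF r] exps_less[OF r, of 1]
  by (intro mult_pos_pos divide_pos_pos prod_pos) auto

text \<open>The point is the inclusion of \<open>a = 0\<close>, where the comparison formulas are
  explicit. There \<open>a powr r (Suc l)\<close> is continuous because \<open>r (Suc l)\<close> is
  positive, and the denominators stay positive by \<open>gap_zero_pos\<close>.\<close>

lemma continuous_coef:
  assumes "exps r"
  shows "continuous_on {0..<1} (\<lambda>a. coef n r a k j)"
  using assms
proof (induction n arbitrary: r k j)
  case 0
  then show ?case by simp
next
  case (Suc n)
  note IH = Suc.IH[OF exps_shift[OF Suc.prems]]
  have pw: "continuous_on {0..<1} (\<lambda>a::real. a powr r (Suc l))" for l
    using exps_pos_Suc[OF Suc.prems] by (intro continuous_on_powr') (auto intro!: continuous_intros)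
  have "continuous_on {0..<1} (\<lambda>a. bint n r a k 1)" for k
    unfolding bint_def prim_def by (intro continuous_intros IH pw)
  moreover have "gap n r a k \<noteq> 0" if "a \<in> {0..<1}" "k \<le> n" for a k
    using gap_zero_pos[OF Suc.prems that(2)] flow_gap_pos[OF flow Suc.prems _ _ that(2), of a] that
    by (cases "a = 0") auto
  ultimately have quot: "continuous_on {0..<1} (\<lambda>a. c a / gap n r a k)"
    if "continuous_on {0..<1} c" "k \<le> n" for c k
    using that by (intro continuous_on_divide) auto
  have "continuous_on {0..<1} (\<lambda>a. tl_coef n r a k j)" for k j
  proof (cases k)
    case (Suc i)
    show ?thesis
    proof (cases "i \<le> n")
      case True
      show ?thesis
        unfolding Suc tail_coef_def nat.case bint_def[symmetric]
        by (rule quot[OF _ True]) (cases j; simp only: nat.case;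
            intro continuous_on_minus continuous_on_sum continuous_on_mult continuous_on_const IH pw)
    qed (simp add: tl_coef_beyond Suc)
  qed (simp add: tail_coef_0)
  then show ?case by (simp add: continuous_on_diff)
qed

text \<open>This identifies the products as the control points of \<open>t powr r l\<close> at
  \<open>a = 0\<close>. For \<open>l > 0\<close> the weight of index 0 vanishes through its factor
  \<open>i = l\<close>, and the increments of the weights are \<open>r l / r 1\<close> times the
  gaps times the weights for \<open>shift r\<close> and \<open>l - 1\<close>; the gaps cancel
  against the denominators of the tails.\<close>

lemma coef_zero_dual:
  assumes "exps r" "l \<le> n"
  shows "(\<Sum>k\<le>n. (\<Prod>i=Suc k..n. 1 - r l / r i) * coef n r 0 k j) = of_bool (j = l)"
  using assms
proof (induction n arbitrary: r l j)
  case 0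
  then show ?case by simp
next
  case (Suc n)
  let ?w = "\<lambda>k. \<Prod>i=Suc k..Suc n. 1 - r l / r i"
  have rp: "\<And>i. r (Suc i) \<noteq> 0" using exps_pos_Suc[OF Suc.prems(1)] by (metis less_irrefl)
  show ?case
  proof (cases l)
    case 0
    then show ?thesis using coef_sum[of "Suc n" r 0 j] Suc.prems by (simp add: exps_0 del: coef.simps sum.atMost_Suc)
  next
    case (Suc m)
    have m: "m \<le> n" using Suc Suc.prems by simp
    have w0: "?w 0 = 0"
      by (rule prod_zero) (use Suc Suc.prems rp in \<open>auto intro!: bexI[of _ l]\<close>)
    have step: "?w (Suc i) - ?w i =
        (r l / r 1) * gap n r 0 i * (\<Prod>q=Suc i..n. 1 - shift r m / shift r q)" if i: "i \<le> n" for i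
    proof -
      have wi: "?w i = (1 - r l / r (Suc i)) * ?w (Suc i)"
        using i by (intro prod.atLeast_Suc_atMost) auto
      have "(\<Prod>q=Suc i..n. 1 - shift r m / shift r q) = (\<Prod>q=Suc (Suc i)..Suc n. (r q - r l) / (r q - r 1))"
        unfolding prod_shift_bounds[symmetric]
      proof (intro prod.cong refl)
        fix q assume q: "q \<in> {Suc i..n}"
        then have "r (Suc q) - r 1 \<noteq> 0" using exps_less[OF Suc.prems(1), of 1 "Suc q"] by simp
        then show "1 - shift r m / shift r q = (r (Suc q) - r l) / (r (Suc q) - r 1)"
          by (simp add: shift_def field_simps Suc)
      qed
      also have "\<dots> = (\<Prod>q=Suc (Suc i)..Suc n. r q - r l) / (\<Prod>q=Suc (Suc i)..Suc n. r q - r 1)"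
        by (simp only: prod_dividef)
      finally have 1: "(\<Prod>q=Suc i..n. 1 - shift r m / shift r q) =
        (\<Prod>q=Suc (Suc i)..Suc n. r q - r l) / (\<Prod>q=Suc (Suc i)..Suc n. r q - r 1)" .
      have "?w (Suc i) = (\<Prod>q=Suc (Suc i)..Suc n. (r q - r l) / r q)"
      proof (intro prod.cong refl)
        fix q assume "q \<in> {Suc (Suc i)..Suc n}"
        then have "r q \<noteq> 0" using rp[of "q - 1"] by simp
        then show "1 - r l / r q = (r q - r l) / r q" by (simp add: field_simps)
      qed
      then have 2: "?w (Suc i) = (\<Prod>q=Suc (Suc i)..Suc n. r q - r l) / (\<Prod>q=Suc (Suc i)..Suc n. r q)"
        by (simp only: prod_dividef)
      have 3: "(\<Prod>q=Suc i..Suc n. r q) = r (Suc i) * (\<Prod>q=Suc (Suc i)..Suc n. r q)"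
        using i by (intro prod.atLeast_Suc_atMost) auto
      have nz: "(\<Prod>q=Suc (Suc i)..Suc n. r q) \<noteq> 0" "(\<Prod>q=Suc (Suc i)..Suc n. r q - r 1) \<noteq> 0"
        using exps_prod_pos[OF Suc.prems(1)] exps_prod_diff_pos[OF Suc.prems(1)]
        by (metis less_irrefl)+
      have "L / R - (1 - s / p) * (L / R) = s / u * (u * (D / (p * R))) * (L / D)"
        if "R \<noteq> 0" "D \<noteq> 0" "p \<noteq> 0" "u \<noteq> 0" for L R s p u D :: real
        using that by (simp add: field_simps)
      from this[OF nz rp[of i] rp[of 0, folded One_nat_def]] show ?thesis
        unfolding wi gap_zero[OF Suc.prems(1) i] 1 2 3 .
    qed
    have "(\<Sum>k\<le>Suc n. ?w k * coef (Suc n) r 0 k j) =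
      (\<Sum>i\<le>n. (?w (Suc i) - ?w i) * tl_coef n r 0 (Suc i) j)"
      unfolding coef_abel w0 by simp
    also have "\<dots> = of_bool (j = l)"
    proof (cases j)
      case j0: 0
      have "tl_coef n r 0 (Suc i) 0 = 0" for i by (simp add: tail_coef_Suc_0)
      then show ?thesis using j0 Suc by (simp only: mult_zero_right sum.neutral_const) simp
    next
      case (Suc p)
      have "(\<Sum>i\<le>n. (?w (Suc i) - ?w i) * tl_coef n r 0 (Suc i) j) =
        (\<Sum>i\<le>n. r l / r (Suc p) * ((\<Prod>q=Suc i..n. 1 - shift r m / shift r q) * coef n (shift r) 0 i p))"
      proof (intro sum.cong refl)
        fix i assume i: "i \<in> {..n}"
        then have g: "gap n r 0 i \<noteq> 0" using gap_zero_pos[OF Suc.prems(1), of i n] by simp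
        have "s / u * h * W * (c * (u / p) / h) = s / p * (W * c)" if "h \<noteq> 0" "u \<noteq> 0" for s u h W c p :: real
          using that by (simp add: field_simps)
        from this[OF g rp[of 0, folded One_nat_def]]
        show "(?w (Suc i) - ?w i) * tl_coef n r 0 (Suc i) j =
          r l / r (Suc p) * ((\<Prod>q=Suc i..n. 1 - shift r m / shift r q) * coef n (shift r) 0 i p)"
          using i unfolding Suc by (simp only: step atMost_iff tail_coef_Suc_Suc bint_def)
      qed
      also have "\<dots> = r l / r (Suc p) * of_bool (p = m)"
        unfolding sum_distrib_left[symmetric] by (simp only: Suc.IH[OF exps_shift[OF Suc.prems(1)] m])
      finally show ?thesis using Suc \<open>l = Suc m\<close> rp by auto
    qed
    finally show ?thesis .
  qed
qed

lemma gap_pos: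
  assumes "exps r" "0 \<le> a" "a < 1" "k \<le> n"
  shows "0 < gap n r a k"
  using gap_zero_pos[OF assms(1,4)] flow_gap_pos[OF flow assms(1) _ assms(3,4)] assms(2)
  by (cases "a = 0") auto

section \<open>Control points\<close>

text \<open>These are the control points of \<open>t powr r 1\<close> for the exponents up to
  \<open>r (Suc n)\<close>; the index \<open>n\<close> is that of the shifted system, which supplies
  the gaps. They are counted down from the last one, which is the value 1 at
  \<open>t = 1\<close>.\<close>

definition cpt :: "nat \<Rightarrow> (nat \<Rightarrow> real) \<Rightarrow> real \<Rightarrow> nat \<Rightarrow> real" where
  "cpt n r a k = 1 - (\<Sum>i=k..n. gap n r a i)"

lemma cpt_Suc: "k \<le> n \<Longrightarrow> cpt n r a (Suc k) = cpt n r a k + gap n r a k"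
  by (simp add: cpt_def sum.atLeast_Suc_atMost)

lemma cpt_top [simp]: "cpt n r a (Suc n) = 1"
  by (simp add: cpt_def)

lemma bint_sum:
  assumes r: "exps r"
  shows "(\<Sum>k\<le>n. bint n r a k t) = t powr r 1 - a powr r 1"
proof -
  have "(\<Sum>k\<le>n. bint n r a k t) =
    (\<Sum>j\<le>n. (\<Sum>k\<le>n. coef n (shift r) a k j) * (r 1 / r (Suc j)) * (t powr r (Suc j) - a powr r (Suc j)))"
    unfolding bint_def prim_def by (subst sum.swap) (simp only: sum_distrib_right)
  also have "\<dots> = (\<Sum>j\<le>n. if j = 0 then t powr r 1 - a powr r 1 else 0)"
    using exps_pos_Suc[OF r, of 0] by (intro sum.cong) (auto simp: coef_sum)
  finally show ?thesis by simp
qed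

lemma cpt_0: assumes "exps r" shows "cpt n r a 0 = a powr r 1"
  using bint_sum[OF assms, of n a 1] by (simp add: cpt_def atMost_atLeast0)

lemma bern_lincomb:
  "(\<Sum>k\<le>n. w k * bern n r a k t) = (\<Sum>j\<le>n. (\<Sum>k\<le>n. w k * coef n r a k j) * t powr r j)"
  unfolding bern_def sum_distrib_left sum_distrib_right by (subst sum.swap) (simp add: mult.assoc)

text \<open>By summation by parts the increments of the control points cancel the denominators of
  the tails. The remaining primitives add up to \<open>t powr r 1 - a powr r 1\<close>, the shifted
  basis being a partition of unity.\<close>

lemma cpt_reproduces:
  assumes r: "exps r" and a: "0 \<le> a" "a < 1" and t: "0 < t"
  shows "(\<Sum>k\<le>Suc n. cpt n r a k * bern (Suc n) r a k t) = t powr r 1"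
proof -
  have "(\<Sum>k\<le>Suc n. cpt n r a k * bern (Suc n) r a k t) =
    (\<Sum>j\<le>Suc n. (cpt n r a 0 * of_bool (j = 0) +
      (\<Sum>i\<le>n. gap n r a i * tl_coef n r a (Suc i) j)) * t powr r j)"
    unfolding bern_lincomb coef_abel
    by (intro sum.cong refl arg_cong2[where f = "(*)"] arg_cong2[where f = "(+)"]) (simp_all add: cpt_Suc)
  also have "\<dots> = (\<Sum>j\<le>Suc n. cpt n r a 0 * of_bool (j = 0) * t powr r j) +
      (\<Sum>i\<le>n. gap n r a i * (\<Sum>j\<le>Suc n. tl_coef n r a (Suc i) j * t powr r j))"
    unfolding distrib_right sum.distrib sum_distrib_left sum_distrib_right
    by (subst (2) sum.swap) (simp only: mult.assoc)
  also have "(\<Sum>j\<le>Suc n. cpt n r a 0 * of_bool (j = 0) * t powr r j) = cpt n r a 0"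
    unfolding sum.atMost_Suc_shift using t exps_0[OF r] by simp
  also have "(\<Sum>i\<le>n. gap n r a i * (\<Sum>j\<le>Suc n. tl_coef n r a (Suc i) j * t powr r j)) =
     (\<Sum>i\<le>n. bint n r a i t)"
    unfolding tl_coef_value[OF r t]
  proof (intro sum.cong refl)
    fix i assume "i \<in> {..n}"
    then have "gap n r a i \<noteq> 0" using gap_pos[OF r a, of i n] by simp
    then show "gap n r a i * (bint n r a i t / gap n r a i) = bint n r a i t" by simp
  qed
  finally show ?thesis by (simp add: bint_sum[OF r] cpt_0[OF r])
qed

lemma cpt_bounds:
  assumes r: "exps r" and a: "0 \<le> a" "a < 1" and k: "k \<le> Suc n"
  shows "a powr r 1 \<le> cpt n r a k" "cpt n r a k \<le> 1"
proof -
  show "cpt n r a k \<le> 1"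
  proof -
    have "0 \<le> (\<Sum>i=k..n. gap n r a i)"
      by (rule sum_nonneg) (use gap_pos[OF r a, THEN less_imp_le] in simp)
    then show ?thesis by (simp add: cpt_def)
  qed
  have "(\<Sum>i=k..n. gap n r a i) \<le> (\<Sum>i=0..n. gap n r a i)"
    using gap_pos[OF r a] by (intro sum_mono2) (auto simp: less_imp_le)
  then show "a powr r 1 \<le> cpt n r a k"
    using cpt_0[OF r, of n a] by (simp add: cpt_def)
qed

lemma DERIV_coef:
  assumes "exps r" "0 < a" "a < 1"
  shows "((\<lambda>a. coef n r a k j) has_real_derivative
        kap n r a k * coef n r a k j -
        (case k of 0 \<Rightarrow> 0 | Suc i \<Rightarrow> kap n r a i * coef n r a i j)) (at a)"
  using flow[of n] assms unfolding flow_def by blast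

lemma kap_nonneg:
  assumes "exps r" "0 < a" "a < 1"
  shows "0 \<le> kap n r a k"
  using flow[of n] assms kap_top[of n k r a] unfolding flow_def
  by (cases "k < n") (auto simp: less_imp_le)

text \<open>The form as a difference of consecutive terms makes the sum in \<open>DERIV_cpt\<close>
  telescope.\<close>

lemma DERIV_gap:
  assumes r: "exps r" and a: "0 < a" "a < 1" and i: "i \<le> n"
  shows "((\<lambda>a. gap n r a i) has_real_derivative
    kap (Suc n) r a (Suc i) * gap n r a (Suc i) - kap (Suc n) r a i * gap n r a i) (at a)"
proof -
  have g: "gap n r a i \<noteq> 0" if "i \<le> n" for i using gap_pos[OF r _ a(2) that] a by simp
  have 1: "kap (Suc n) r a (Suc i) * gap n r a (Suc i) = kap n (shift r) a i * gap n r a i"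
    using g[of "Suc i"] kap_top[of n i "shift r" a] i by (cases "i = n") (auto simp: bint_beyond)
  have 2: "kap (Suc n) r a i * gap n r a i =
    (case i of 0 \<Rightarrow> r 1 * a powr (r 1 - 1) | Suc l \<Rightarrow> kap n (shift r) a l * gap n r a l)"
    using g[OF i] by (cases i) auto
  show ?thesis
    unfolding 1 2 by (intro DERIV_bint r a DERIV_coef exps_shift)
qed

lemma DERIV_cpt:
  assumes r: "exps r" and a: "0 < a" "a < 1" and k: "k \<le> Suc n"
  shows "((\<lambda>a. cpt n r a k) has_real_derivative kap (Suc n) r a k * gap n r a k) (at a)"
proof -
  let ?h = "\<lambda>i. kap (Suc n) r a i * gap n r a i"
  have "((\<lambda>a. cpt n r a k) has_real_derivative 0 - (\<Sum>i=k..n. ?h (Suc i) - ?h i)) (at a)"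
    unfolding cpt_def by (intro derivative_intros DERIV_gap r a) auto
  also have "(\<Sum>i=k..n. ?h (Suc i) - ?h i) = ?h (Suc n) - ?h k"
    using k by (rule sum_Suc_diff)
  finally show ?thesis by (simp add: bint_beyond del: kap.simps)
qed

lemma bern_at_right:
  assumes r: "exps r" and a: "0 \<le> a" "a < 1" and k: "k \<le> Suc n"
  shows "bern (Suc n) r a k 1 = of_bool (k = Suc n)"
proof -
  have g: "gap n r a i / gap n r a i = of_bool (i \<le> n)" for i
    using gap_pos[OF r a, of i n] bint_beyond[of n i r a 1] by (cases "i \<le> n") auto
  show ?thesis
    using k by (cases k; simp only: bern_Suc_0[OF r zero_less_one] bern_Suc_Suc[OF r zero_less_one] g) auto
qed

lemma bern_nonneg:
  assumes r: "exps r" and a: "0 < a" "a < 1" "a \<le> t" "t \<le> 1" and k: "k \<le> Suc n"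
  shows "0 \<le> bern (Suc n) r a k t"
proof -
  consider "t = a" | "t = 1" | "a < t" "t < 1" using a by linarith
  then show ?thesis
  proof cases
    case 3
    then show ?thesis using flow[of "Suc n"] r a k unfolding flow_def by (blast intro: less_imp_le)
  qed (use a k in \<open>auto simp: bern_at_left[OF r] bern_at_right[OF r]\<close>)
qed

lemma continuous_bern:
  assumes "exps r"
  shows "continuous_on {0..<1} (\<lambda>a. bern n r a k t)"
  unfolding bern_def by (intro continuous_intros continuous_coef assms)

text \<open>Positivity was derived for positive left end points; continuity carries it to the limit
  0.\<close>

lemma bern_zero_nonneg:
  assumes r: "exps r" and t: "0 < t" "t \<le> 1" and k: "k \<le> Suc n"
  shows "0 \<le> bern (Suc n) r 0 k t"
proof (rule continuous_ge_on_closure[where S = "{0<..<t/2}" and f = "\<lambda>a. bern (Suc n) r a k t"])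
  have "closure {0<..<t/2} = {0..t/2}" using t by simp
  then show "0 \<in> closure {0<..<t/2}" "continuous_on (closure {0<..<t/2}) (\<lambda>a. bern (Suc n) r a k t)"
    using t by (auto intro: continuous_on_subset[OF continuous_bern[OF r]])
  show "0 \<le> bern (Suc n) r a k t" if "a \<in> {0<..<t/2}" for a
    using that t by (intro bern_nonneg r k) auto
qed

lemma continuous_cpt:
  assumes "exps r"
  shows "continuous_on {0..<1} (\<lambda>a. cpt n r a k)"
proof -
  have pw: "continuous_on {0..<1} (\<lambda>a::real. a powr r (Suc l))" for l
    using exps_pos_Suc[OF assms] by (intro continuous_on_powr') (auto intro!: continuous_intros)
  have "continuous_on {0..<1} (\<lambda>a. coef n (shift r) a i j)" for i j
    by (intro continuous_coef exps_shift assms)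
  then show ?thesis
    unfolding cpt_def bint_def prim_def
    by (intro continuous_on_diff continuous_on_sum continuous_on_mult continuous_on_const pw)
qed

section \<open>Convexity and the Jensen defect\<close>

lemma powr_strong_convex:
  fixes p c x y :: real
  assumes p: "1 < p" and c: "0 < c" "c \<le> x" "x \<le> 1" "c \<le> y" "y \<le> 1"
  shows "p * (p - 1) * c powr p / 2 * (y - x)\<^sup>2 \<le> y powr p - x powr p - p * x powr (p - 1) * (y - x)"
proof -
  \<comment> \<open>A lower bound for the second derivative
    \<open>p * (p - 1) * z powr (p - 2)\<close> on \<open>{c..1}\<close>, valid for
    \<open>p < 2\<close> and \<open>p >= 2\<close> alike because \<open>c powr p\<close> is at most
    \<open>z powr p\<close>, hence at most \<open>z powr (p - 2)\<close>. Subtracting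
    \<open>m / 2 * z\<^sup>2\<close> therefore leaves a convex function.\<close>
  define m where "m = p * (p - 1) * c powr p"
  have "(p * x powr (p - 1) - m * x) * (y - x) \<le>
      (y powr p - m / 2 * y\<^sup>2) - (x powr p - m / 2 * x\<^sup>2)"
  proof (rule f''_imp_f'[where C = "{c..1}" and f'' = "\<lambda>z. p * ((p - 1) * z powr (p - 2)) - m"])
    fix z assume z: "z \<in> {c..1}"
    then have z0: "0 < z" using c by auto
    show "((\<lambda>z. z powr p - m / 2 * z\<^sup>2) has_real_derivative p * z powr (p - 1) - m * z) (at z)"
      using z0 by (auto intro!: derivative_eq_intros)
    show "((\<lambda>z. p * z powr (p - 1) - m * z) has_real_derivative
        p * ((p - 1) * z powr (p - 2)) - m) (at z)"
      using z0 by (auto intro!: derivative_eq_intros simp: algebra_simps)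
    have "c powr p \<le> z powr p" using z c p by (intro powr_mono2) auto
    also have "\<dots> \<le> z powr (p - 2)" using z c by (intro powr_mono') auto
    finally show "0 \<le> p * ((p - 1) * z powr (p - 2)) - m"
      using p by (simp add: m_def mult_left_mono mult.assoc)
  qed (use c in auto)
  then show ?thesis unfolding m_def[symmetric] by (simp add: power2_eq_square field_simps)
qed

text \<open>The derivative in the left end point is minus the sum of \<open>kap k * B k\<close>
  times the excess of the power at control point \<open>k + 1\<close> over its tangent at control
  point \<open>k\<close>. Each such excess is nonnegative by convexity.\<close>

lemma powr_mean_antimono:
  assumes r: "exps r" and a: "0 < a" "a < 1" "a \<le> t" "t \<le> 1" and p: "1 < p"
  shows "(\<Sum>k\<le>Suc n. bern (Suc n) r a k t * cpt n r a k powr p) \<le>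
    (\<Sum>k\<le>Suc n. bern (Suc n) r 0 k t * cpt n r 0 k powr p)"
proof (rule DERIV_nonpos_imp_decreasing_open[where f = "\<lambda>a. \<Sum>k\<le>Suc n. bern (Suc n) r a k t * cpt n r a k powr p"])
  have "continuous_on {0..<1} (\<lambda>a. cpt n r a k powr p)" if "k \<le> Suc n" for k
  proof (intro continuous_on_powr' continuous_cpt r continuous_on_const ballI conjI impI)
    fix x :: real assume "x \<in> {0..<1}"
    then show "0 \<le> cpt n r x k" using cpt_bounds(1)[OF r, of x k n] that by (auto intro: order_trans[rotated])
  qed (use p in auto)
  then have "continuous_on {0..<1} (\<lambda>a. \<Sum>k\<le>Suc n. bern (Suc n) r a k t * cpt n r a k powr p)"
    by (intro continuous_on_sum continuous_on_mult continuous_bern r) auto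
  then show "continuous_on {0..a} (\<lambda>a. \<Sum>k\<le>Suc n. bern (Suc n) r a k t * cpt n r a k powr p)"
    by (rule continuous_on_subset) (use a in auto)
next
  fix x assume x: "0 < x" "x < a"
  then have x1: "x < 1" using a by simp
  let ?K = "kap (Suc n) r x" and ?B = "\<lambda>k. bern (Suc n) r x k t" and ?e = "cpt n r x"
  let ?low = "\<lambda>k. case k of 0 \<Rightarrow> 0 | Suc i \<Rightarrow> ?K i * ?B i"
  have e0: "0 < ?e k" if "k \<le> Suc n" for k
    using cpt_bounds(1)[OF r _ x1 that] x powr_gt_zero[of x "r 1"] by linarith
  let ?D = "\<Sum>k\<le>Suc n. (?K k * ?B k - ?low k) * ?e k powr p +
      (p * ?e k powr (p - 1) * (?K k * gap n r x k)) * ?B k"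
  have "((\<lambda>a. \<Sum>k\<le>Suc n. bern (Suc n) r a k t * cpt n r a k powr p) has_real_derivative ?D) (at x)"
  proof (intro DERIV_sum DERIV_mult DERIV_bern DERIV_coef r x x1)
    fix k assume k: "k \<in> {..Suc n}"
    show "((\<lambda>a. cpt n r a k powr p) has_real_derivative
      p * ?e k powr (p - 1) * (?K k * gap n r x k)) (at x)"
      by (rule has_real_derivative_powr[THEN DERIV_chain2])
        (use k e0 in \<open>auto intro!: DERIV_cpt r x x1 simp del: kap.simps\<close>)
  qed
  moreover have "?D \<le> 0"
  proof -
    \<comment> \<open>Index shift in the inflow term; the added last summand is 0 because the top
      rate vanishes.\<close>
    have "(\<Sum>k\<le>Suc n. ?low k * ?e k powr p) = (\<Sum>k\<le>Suc n. ?K k * ?B k * ?e (Suc k) powr p)"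
      unfolding sum.atMost_Suc_shift[of "\<lambda>k. ?low k * ?e k powr p"]
      by (simp add: kap_top del: kap.simps)
    then have "?D = (\<Sum>k\<le>Suc n. ?K k * ?B k * ?e k powr p) - (\<Sum>k\<le>Suc n. ?K k * ?B k * ?e (Suc k) powr p)
       + (\<Sum>k\<le>Suc n. (p * ?e k powr (p - 1) * (?K k * gap n r x k)) * ?B k)"
      by (simp only: left_diff_distrib sum_subtractf sum.distrib)
    also have "\<dots> = - (\<Sum>k\<le>Suc n. (?K k * ?B k) * (?e (Suc k) powr p - ?e k powr p - p * ?e k powr (p - 1) * gap n r x k))"
      unfolding sum_subtractf[symmetric] sum.distrib[symmetric] sum_negf[symmetric]
      by (intro sum.cong refl) (simp add: algebra_simps del: kap.simps)
    also have "\<dots> \<le> 0"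
      unfolding neg_le_0_iff_le
    proof (intro sum_nonneg)
      fix k assume k: "k \<in> {..Suc n}"
      show "0 \<le> (?K k * ?B k) * (?e (Suc k) powr p - ?e k powr p - p * ?e k powr (p - 1) * gap n r x k)"
      proof (cases "k = Suc n")
        case False
        then have kn: "k \<le> n" using k by simp
        have "0 \<le> p * (p - 1) * (x powr r 1) powr p / 2 * (?e (Suc k) - ?e k)\<^sup>2"
          using p by simp
        also have "\<dots> \<le> ?e (Suc k) powr p - ?e k powr p - p * ?e k powr (p - 1) * (?e (Suc k) - ?e k)"
          using x kn by (intro powr_strong_convex p cpt_bounds r x1) auto
        finally show ?thesis
          using kn x x1 a k by (intro mult_nonneg_nonneg kap_nonneg bern_nonneg r) (auto simp: cpt_Suc)
      qed (simp add: kap_top del: kap.simps)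
    qed
    finally show ?thesis .
  qed
  ultimately show "\<exists>y. ((\<lambda>a. \<Sum>k\<le>Suc n. bern (Suc n) r a k t * cpt n r a k powr p) has_real_derivative y) (at x) \<and> y \<le> 0"
    by blast
qed (use a in simp)

text \<open>The gaps at \<open>a = 0\<close> are the increments of these products, and both sides
  are 1 at \<open>k = Suc n\<close>.\<close>

lemma cpt_zero:
  assumes r: "exps r" and k: "k \<le> Suc n"
  shows "cpt n r 0 k = (\<Prod>i=Suc k..Suc n. 1 - r 1 / r i)"
proof -
  let ?w = "\<lambda>k. \<Prod>i=Suc k..Suc n. 1 - r 1 / r i"
  have step: "gap n r 0 i = ?w (Suc i) - ?w i" if i: "i \<le> n" for i
  proof -
    have 1: "?w i = (1 - r 1 / r (Suc i)) * ?w (Suc i)"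
      using i by (intro prod.atLeast_Suc_atMost) auto
    have "?w (Suc i) = (\<Prod>q=Suc (Suc i)..Suc n. (r q - r 1) / r q)"
    proof (intro prod.cong refl)
      fix q assume "q \<in> {Suc (Suc i)..Suc n}"
      then have "0 < r q" using exps_pos[OF r, of q] by simp
      then show "1 - r 1 / r q = (r q - r 1) / r q" by (simp add: field_simps)
    qed
    then have 2: "?w (Suc i) = (\<Prod>q=Suc (Suc i)..Suc n. r q - r 1) / (\<Prod>q=Suc (Suc i)..Suc n. r q)"
      by (simp only: prod_dividef)
    have 3: "(\<Prod>q=Suc i..Suc n. r q) = r (Suc i) * (\<Prod>q=Suc (Suc i)..Suc n. r q)"
      using i by (intro prod.atLeast_Suc_atMost) auto
    have "u * (D / (p * R)) = D / R - (1 - u / p) * (D / R)" for u D p R :: real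
      by (simp add: algebra_simps)
    then show ?thesis unfolding gap_zero[OF r i] 1 2 3 .
  qed
  have "(\<Sum>i=k..n. gap n r 0 i) = (\<Sum>i=k..n. ?w (Suc i) - ?w i)"
    by (intro sum.cong refl step) auto
  also have "\<dots> = ?w (Suc n) - ?w k" using k by (rule sum_Suc_diff)
  finally show ?thesis by (simp add: cpt_def)
qed

text \<open>Strong convexity bounds the weighted mean of the squared distances to
  \<open>t powr r 1\<close> by the Jensen defect. The defect is at most that mean at
  \<open>a = 0\<close> minus \<open>t powr r 2\<close>, which is a mean of quantities bounded by
  \<open>e\<close>. Some index does no worse than the mean.\<close>

lemma cpt_near:
  assumes r: "exps r" and a: "0 < a" "a < 1" "a \<le> t" "t \<le> 1" and n: "1 \<le> n"
    and e: "\<And>k. k \<le> Suc n \<Longrightarrow>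
      (\<Prod>i=Suc k..Suc n. 1 - r 1 / r i) powr (r 2 / r 1) - (\<Prod>i=Suc k..Suc n. 1 - r 2 / r i) \<le> e"
  obtains k where "k \<le> Suc n"
    "(r 2 / r 1) * (r 2 / r 1 - 1) * a powr r 2 / 2 * (cpt n r a k - t powr r 1)\<^sup>2 \<le> e"
proof -
  define p where "p = r 2 / r 1"
  have r1: "0 < r 1" using exps_pos[OF r] by simp
  have p: "1 < p" using exps_less[OF r, of 1 2] r1 by (simp add: p_def)
  have t: "0 < t" using a by simp
  let ?z = "\<lambda>k. \<Prod>i=Suc k..Suc n. 1 - r 1 / r i" and ?th = "\<lambda>k. \<Prod>i=Suc k..Suc n. 1 - r 2 / r i"
  let ?B = "\<lambda>k. bern (Suc n) r a k t" and ?e = "cpt n r a" and ?y = "t powr r 1"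
  let ?c = "p * (p - 1) * (a powr r 1) powr p / 2"
  have yp: "?y powr p = t powr r 2" using r1 by (simp add: powr_powr p_def)
  have B: "0 \<le> ?B k" if "k \<le> Suc n" for k using that a by (intro bern_nonneg r)
  \<comment> \<open>\<open>t powr r 2\<close> is expanded in the basis for \<open>a = 0\<close>, so
    that it can be subtracted termwise; \<open>1 <= n\<close> puts \<open>r 2\<close> among the
    exponents.\<close>
  have "(\<Sum>k\<le>Suc n. ?th k * bern (Suc n) r 0 k t) = (\<Sum>j\<le>Suc n. of_bool (j = 2) * t powr r j)"
    unfolding bern_lincomb using coef_zero_dual[OF r, of 2 "Suc n"] n by (simp only:)
  also have "\<dots> = (\<Sum>j\<le>Suc n. if j = 2 then t powr r j else 0)" by (intro sum.cong) auto
  also have "\<dots> = t powr r 2" using n by (simp only: sum.delta finite_atMost) auto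
  finally have th: "(\<Sum>k\<le>Suc n. ?th k * bern (Suc n) r 0 k t) = t powr r 2" .
  have "(\<Sum>k\<le>Suc n. ?B k * (?c * (?e k - ?y)\<^sup>2)) \<le>
     (\<Sum>k\<le>Suc n. ?B k * (?e k powr p - ?y powr p - p * ?y powr (p - 1) * (?e k - ?y)))"
  proof (intro sum_mono mult_left_mono B powr_strong_convex p cpt_bounds r)
    show "a powr r 1 \<le> ?y" using a r1 by (intro powr_mono2) auto
    show "?y \<le> 1" using a r1 powr_mono2[of "r 1" t 1] by simp
  qed (use a in auto)
  also have "\<dots> = (\<Sum>k\<le>Suc n. ?B k * ?e k powr p) - ?y powr p * (\<Sum>k\<le>Suc n. ?B k)
     - p * ?y powr (p - 1) * ((\<Sum>k\<le>Suc n. ?e k * ?B k) - ?y * (\<Sum>k\<le>Suc n. ?B k))"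
    unfolding sum_distrib_left sum_subtractf[symmetric]
    by (intro sum.cong refl) (simp add: algebra_simps)
  also have "\<dots> = (\<Sum>k\<le>Suc n. ?B k * ?e k powr p) - t powr r 2"
    using bern_sum[OF r t, of "Suc n" a] cpt_reproduces[OF r _ a(2) t, of n] a
    by (simp only: yp) simp
  also have "\<dots> \<le> (\<Sum>k\<le>Suc n. bern (Suc n) r 0 k t * cpt n r 0 k powr p) - t powr r 2"
    using powr_mean_antimono[OF r a p] by simp
  also have "\<dots> = (\<Sum>k\<le>Suc n. bern (Suc n) r 0 k t * (?z k powr p - ?th k))"
    unfolding th[symmetric] sum_subtractf[symmetric]
    by (intro sum.cong refl) (simp add: cpt_zero[OF r] algebra_simps del: prod.cl_ivl_Suc)
  also have "\<dots> \<le> (\<Sum>k\<le>Suc n. bern (Suc n) r 0 k t * e)"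
    using e[folded p_def] by (intro sum_mono mult_left_mono bern_zero_nonneg r t a) auto
  also have "\<dots> = e"
    using bern_sum[OF r t, of "Suc n" 0] by (simp flip: sum_distrib_right del: sum.atMost_Suc)
  finally have le: "(\<Sum>k\<le>Suc n. ?B k * (?c * (?e k - ?y)\<^sup>2)) \<le> e" .
  have "\<exists>k\<le>Suc n. ?c * (?e k - ?y)\<^sup>2 \<le> e"
  proof (rule ccontr)
    assume "\<not> ?thesis"
    then have gt: "e < ?c * (?e k - ?y)\<^sup>2" if "k \<le> Suc n" for k using that by force
    \<comment> \<open>A nonzero weight makes the comparison of the weighted sums strict.\<close>
    obtain k0 where k0: "k0 \<le> Suc n" "?B k0 \<noteq> 0"
      using bern_sum[OF r t, of "Suc n" a] by (metis (mono_tags, lifting) atMost_iff sum.neutral zero_neq_one)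
    have "(\<Sum>k\<le>Suc n. ?B k * e) < (\<Sum>k\<le>Suc n. ?B k * (?c * (?e k - ?y)\<^sup>2))"
    proof (rule sum_strict_mono_ex1)
      show "\<forall>k\<in>{..Suc n}. ?B k * e \<le> ?B k * (?c * (?e k - ?y)\<^sup>2)"
        using mult_left_mono[OF less_imp_le[OF gt] B] by simp
      show "\<exists>k\<in>{..Suc n}. ?B k * e < ?B k * (?c * (?e k - ?y)\<^sup>2)"
        using k0 B[OF k0(1)] gt[OF k0(1)] by (intro bexI[of _ k0] mult_strict_left_mono) auto
    qed simp
    then show False
      using le bern_sum[OF r t, of "Suc n" a] by (simp flip: sum_distrib_right del: sum.atMost_Suc)
  qed
  moreover have "(a powr r 1) powr p = a powr r 2" using r1 by (simp add: powr_powr p_def)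
  ultimately show ?thesis using that p_def by auto
qed

section \<open>Multiplicity of zeros and uniqueness of the basis\<close>

text \<open>The falling factorial \<open>x (x - 1) ... (x - m + 1)\<close>, the factor produced by
  the \<open>m\<close>-th derivative of \<open>t powr x\<close>.\<close>

definition ffact_poly :: "nat \<Rightarrow> real poly" where
  "ffact_poly m = (\<Prod>i<m. [:- of_nat i, 1:])"

lemma ffact_poly_Suc: "poly (ffact_poly (Suc m)) x = poly (ffact_poly m) x * (x - of_nat m)"
  by (simp add: ffact_poly_def poly_prod algebra_simps)

lemma degree_ffact_poly: "degree (ffact_poly m) = m"
  unfolding ffact_poly_def by (subst degree_prod_eq_sum_degree) auto

lemma lead_coeff_ffact_poly: "coeff (ffact_poly m) m = 1"
proof -
  have "lead_coeff (ffact_poly m) = 1"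
    unfolding ffact_poly_def lead_coeff_prod by simp
  then show ?thesis by (simp add: degree_ffact_poly)
qed

lemma higher_deriv_powr_sum:
  fixes c e :: "nat \<Rightarrow> real"
  assumes "\<And>t. 0 < t \<Longrightarrow> f t = (\<Sum>j\<le>n. c j * t powr e j)" and "0 < x"
  shows "(deriv ^^ m) f x = (\<Sum>j\<le>n. c j * x powr e j * poly (ffact_poly m) (e j)) / x ^ m"
  using assms(2)
proof (induction m arbitrary: x)
  case 0
  then show ?case using assms(1) by (simp add: ffact_poly_def)
next
  case (Suc m)
  let ?F = "\<lambda>m x. \<Sum>j\<le>n. c j * (poly (ffact_poly m) (e j) * x powr (e j - of_nat m))"
  have F: "(\<Sum>j\<le>n. c j * x powr e j * poly (ffact_poly m) (e j)) / x ^ m = ?F m x" if "0 < x" for m and x :: real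
    unfolding sum_divide_distrib using that
    by (intro sum.cong refl) (simp add: powr_diff powr_realpow)
  have "(?F m has_real_derivative ?F (Suc m) x) (at x)"
  proof (intro DERIV_sum DERIV_cmult)
    fix j
    show "((\<lambda>x. poly (ffact_poly m) (e j) * x powr (e j - of_nat m)) has_real_derivative
      poly (ffact_poly (Suc m)) (e j) * x powr (e j - of_nat (Suc m))) (at x)"
      using Suc.prems
      by (auto intro!: derivative_eq_intros simp: ffact_poly_Suc algebra_simps)
  qed
  then have "((deriv ^^ m) f has_real_derivative ?F (Suc m) x) (at x)"
    by (rule has_field_derivative_transform_within_open[where S = "{0<..}"])
      (use Suc F in auto)
  then show ?case using F[OF Suc.prems, of "Suc m"] by (simp add: DERIV_imp_deriv)
qed

text \<open>For \<open>u j = c j * x powr e j\<close>, the \<open>m\<close>-th derivative at \<open>x\<close> of the sum of the \<open>c j * t powr e j\<close>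
  is, up to the factor \<open>x ^ m\<close>, the sum of the \<open>u j * q (e j)\<close> for a polynomial \<open>q\<close> of degree \<open>m\<close>.
  Testing against all polynomials makes the condition invariant under shifts of the exponents.\<close>

definition exact_order :: "nat \<Rightarrow> (nat \<Rightarrow> real) \<Rightarrow> (nat \<Rightarrow> real) \<Rightarrow> nat \<Rightarrow> bool" where
  "exact_order n e u k \<longleftrightarrow>
    (\<exists>M. M \<noteq> 0 \<and> (\<forall>q. degree q \<le> k \<longrightarrow> (\<Sum>j\<le>n. u j * poly q (e j)) = M * coeff q k))"

lemma exact_order_lower:
  assumes "exact_order n e u k" "degree q < k"
  shows "(\<Sum>j\<le>n. u j * poly q (e j)) = 0"
  using assms coeff_eq_0[of q k] unfolding exact_order_def by (metis less_imp_le mult_zero_right)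

lemma exact_order_zero_mult:
  assumes f: "\<And>t. 0 < t \<Longrightarrow> f t = (\<Sum>j\<le>n. c j * t powr e j)" and x: "0 < x"
    and ord: "exact_order n e (\<lambda>j. c j * x powr e j) k"
  shows "zero_mult f x k"
proof -
  have d: "(deriv ^^ m) f x = (\<Sum>j\<le>n. c j * x powr e j * poly (ffact_poly m) (e j)) / x ^ m" for m
    by (rule higher_deriv_powr_sum[of f, OF f x])
  obtain M where "M \<noteq> 0" "(\<Sum>j\<le>n. c j * x powr e j * poly (ffact_poly k) (e j)) = M"
    using ord unfolding exact_order_def by (metis degree_ffact_poly lead_coeff_ffact_poly mult.right_neutral order_refl)
  moreover have "(\<Sum>j\<le>n. c j * x powr e j * poly (ffact_poly m) (e j)) = 0" if "m < k" for m
    using exact_order_lower[OF ord, of "ffact_poly m"] that by (simp add: degree_ffact_poly)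
  ultimately show ?thesis unfolding zero_mult_def d using x by auto
qed

lemma exact_order_const: "r 0 = 0 \<Longrightarrow> exact_order n r (\<lambda>j. of_bool (j = 0)) 0"
proof -
  assume "r 0 = 0"
  then have "(\<Sum>j\<le>n. of_bool (j = 0) * poly q (r j)) = 1 * coeff q 0" for q :: "real poly"
    by (cases n) (auto simp: sum.atMost_Suc_shift poly_0_coeff_0 simp del: sum.atMost_Suc)
  then show ?thesis unfolding exact_order_def by (intro exI[of _ 1]) auto
qed

text \<open>A primitive vanishing at the point gains one order. Write \<open>q = q0 + x p\<close>:
  the constant part is annihilated by \<open>v0\<close>, and the rest tests \<open>u\<close> against
  \<open>p\<close> translated by \<open>r 1\<close>, which keeps the degree and the leading
  coefficient of \<open>p\<close>.\<close>

lemma exact_order_integrate: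
  assumes ord: "exact_order n (shift r) u k" and b: "b \<noteq> 0" and r0: "r 0 = 0"
    and v: "\<And>j. j \<le> n \<Longrightarrow> v (Suc j) * r (Suc j) = b * u j"
    and v0: "(\<Sum>j\<le>Suc n. v j) = 0"
  shows "exact_order (Suc n) r v (Suc k)"
proof -
  obtain M where M: "M \<noteq> 0"
    "\<And>q. degree q \<le> k \<Longrightarrow> (\<Sum>j\<le>n. u j * poly q (shift r j)) = M * coeff q k"
    using ord unfolding exact_order_def by blast
  have "(\<Sum>j\<le>Suc n. v j * poly q (r j)) = b * M * coeff q (Suc k)" if q: "degree q \<le> Suc k" for q
  proof -
    obtain q0 p where qp: "q = pCons q0 p" by (cases q)
    have p: "degree p \<le> k" using q unfolding qp by (auto split: if_splits)
    let ?s = "pcompose p [:r 1, 1:]"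
    have s: "degree ?s \<le> k" "coeff ?s k = coeff p k"
    proof -
      have d: "degree ?s = degree p" by (simp add: degree_pcompose)
      then show "degree ?s \<le> k" using p by simp
      show "coeff ?s k = coeff p k"
      proof (cases "degree p = k")
        case True
        then show ?thesis using lead_coeff_comp[of "[:r 1, 1:]" p] d by simp
      next
        case False
        then show ?thesis using p d by (simp add: coeff_eq_0)
      qed
    qed
    have "(\<Sum>j\<le>Suc n. v j * poly q (r j)) = (\<Sum>j\<le>Suc n. q0 * v j + v j * r j * poly p (r j))"
      by (intro sum.cong refl) (simp add: qp algebra_simps)
    also have "\<dots> = (\<Sum>j\<le>Suc n. v j * r j * poly p (r j))"
      using v0 by (simp only: sum.distrib sum_distrib_left[symmetric] mult_zero_right add_0)
    also have "\<dots> = (\<Sum>j\<le>n. v (Suc j) * r (Suc j) * poly p (r (Suc j)))"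
      unfolding sum.atMost_Suc_shift using r0 by simp
    also have "\<dots> = b * (\<Sum>j\<le>n. u j * poly ?s (shift r j))"
      unfolding sum_distrib_left using v
      by (intro sum.cong) (auto simp: poly_pcompose shift_def)
    finally show ?thesis using M(2)[OF s(1)] s(2) by (simp add: qp)
  qed
  then show ?thesis unfolding exact_order_def using M(1) b
    by (intro exI[of _ "b * M"]) auto
qed

lemma exact_order_diff:
  assumes "exact_order n e u k"
    and "\<And>q. degree q \<le> k \<Longrightarrow> (\<Sum>j\<le>n. v j * poly q (e j)) = 0"
  shows "exact_order n e (\<lambda>j. u j - v j) k"
  using assms unfolding exact_order_def by (simp add: left_diff_distrib sum_subtractf)

text \<open>The tail from \<open>k + 1\<close> on is a primitive vanishing at \<open>a\<close>,
  hence of order \<open>k + 1\<close>. Subtracting it from the tail of order \<open>k\<close> does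
  not change that order.\<close>

lemma coef_order_left:
  assumes "exps r" "0 < a" "a < 1" "k \<le> n"
  shows "exact_order n r (\<lambda>j. coef n r a k j * a powr r j) k"
  using assms(1,4)
proof (induction n arbitrary: r k)
  case 0
  then show ?case using assms exact_order_const[of r 0]
    by (simp add: exps_0 exact_order_def)
next
  case (Suc n)
  note r = Suc.prems(1)
  let ?v = "\<lambda>k j. tl_coef n r a k j * a powr r j"
  have S: "exact_order (Suc n) r (?v (Suc k)) (Suc k)" if k: "k \<le> n" for k
  proof (rule exact_order_integrate[OF Suc.IH[OF exps_shift[OF r] k]])
    show "r 1 * a powr r 1 / gap n r a k \<noteq> 0"
      using gap_pos[OF r _ assms(3) k] exps_pos[OF r, of 1] assms(2) by simp
    show "?v (Suc k) (Suc j) * r (Suc j) =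
        r 1 * a powr r 1 / gap n r a k * (coef n (shift r) a k j * a powr shift r j)" for j
    proof -
      have "a powr r (Suc j) = a powr r 1 * a powr shift r j"
        by (simp add: shift_def flip: powr_add)
      then show ?thesis using exps_pos_Suc[OF r, of j]
        by (simp add: tail_coef_Suc_Suc bint_def)
    qed
    show "(\<Sum>j\<le>Suc n. ?v (Suc k) j) = 0"
      using tl_coef_value[OF r assms(2), of n a k] by simp
  qed (rule exps_0[OF r])
  have "exact_order (Suc n) r (\<lambda>j. ?v k j - ?v (Suc k) j) k"
  proof (rule exact_order_diff)
    show "exact_order (Suc n) r (?v k) k"
    proof (cases k)
      case 0
      have *: "(\<lambda>j. of_bool (j = 0) * a powr r j) = (\<lambda>j. of_bool (j = 0))"
      proof
        show "of_bool (j = 0) * a powr r j = of_bool (j = 0)" for j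
          using exps_0[OF r] assms(2) by (cases "j = 0") auto
      qed
      then show ?thesis
        using exact_order_const[of r "Suc n"] exps_0[OF r] unfolding 0 tail_coef_0 * by simp
    qed (use S Suc.prems in auto)
    show "(\<Sum>j\<le>Suc n. ?v (Suc k) j * poly q (r j)) = 0" if "degree q \<le> k" for q
    proof (cases "k \<le> n")
      case True
      then show ?thesis using exact_order_lower[OF S[OF True]] that by simp
    qed (simp add: tl_coef_beyond)
  qed
  then show ?case by (simp add: left_diff_distrib)
qed

text \<open>Mirror image of the argument at \<open>a\<close>: the complements
  \<open>1 - tail\<close>, that is, the sums of the first basis functions, are primitives that
  vanish at 1.\<close>

lemma coef_order_right:
  assumes "exps r" "0 < a" "a < 1" "k \<le> n"
  shows "exact_order n r (coef n r a k) (n - k)"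
  using assms(1,4)
proof (induction n arbitrary: r k)
  case 0
  then show ?case using exact_order_const[of r 0]
    by (simp add: exps_0 exact_order_def)
next
  case (Suc n)
  note r = Suc.prems(1)
  let ?v = "\<lambda>k j. of_bool (j = 0) - tl_coef n r a k j"
  have S: "exact_order (Suc n) r (?v (Suc k)) (Suc n - k)" if k: "k \<le> n" for k
  proof -
    have g: "0 < gap n r a k" using gap_pos[OF r _ assms(3) k] assms(2) by simp
    have "exact_order (Suc n) r (?v (Suc k)) (Suc (n - k))"
    proof (rule exact_order_integrate[OF Suc.IH[OF exps_shift[OF r] k]])
      show "- (r 1 / gap n r a k) \<noteq> 0" using g exps_pos[OF r, of 1] by simp
      show "?v (Suc k) (Suc j) * r (Suc j) = - (r 1 / gap n r a k) * coef n (shift r) a k j" for j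
        using exps_pos_Suc[OF r, of j] by (simp add: tail_coef_Suc_Suc bint_def)
      show "(\<Sum>j\<le>Suc n. ?v (Suc k) j) = 0"
        using tl_coef_value[OF r zero_less_one, of n a k] g
        unfolding sum_subtractf by (simp del: sum.atMost_Suc)
    qed (rule exps_0[OF r])
    then show ?thesis using k by (simp add: Suc_diff_le)
  qed
  have "exact_order (Suc n) r (\<lambda>j. ?v (Suc k) j - ?v k j) (Suc n - k)"
  proof (rule exact_order_diff)
    show "exact_order (Suc n) r (?v (Suc k)) (Suc n - k)"
    proof (cases "k \<le> n")
      case False
      then have "k = Suc n" using Suc.prems by simp
      then show ?thesis using exact_order_const[of r "Suc n"] exps_0[OF r] by (simp add: tl_coef_beyond)
    qed (rule S)
    show "(\<Sum>j\<le>Suc n. ?v k j * poly q (r j)) = 0" if q: "degree q \<le> Suc n - k" for q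
    proof (cases k)
      case (Suc i)
      then have i: "i \<le> n" using Suc.prems by simp
      then show ?thesis unfolding Suc by (intro exact_order_lower[OF S]) (use q Suc in auto)
    qed (simp add: tail_coef_0)
  qed
  then show ?case by simp
qed

lemma bern_zero_mult_left:
  assumes "exps r" "0 < a" "a < 1" "k \<le> n"
  shows "zero_mult (bern n r a k) a k"
  by (rule exact_order_zero_mult[OF bern_def assms(2) coef_order_left[OF assms]])

lemma bern_zero_mult_right:
  assumes "exps r" "0 < a" "a < 1" "k \<le> n"
  shows "zero_mult (bern n r a k) 1 (n - k)"
  by (rule exact_order_zero_mult[OF bern_def]) (use coef_order_right[OF assms] in simp_all)

section \<open>Spanning, independence and uniqueness\<close>

lemma coef_span:
  assumes "exps r" "0 \<le> a" "a < 1"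
  shows "\<exists>w. \<forall>j\<le>n. c j = (\<Sum>k\<le>n. w k * coef n r a k j)"
  using assms(1)
proof (induction n arbitrary: r c)
  case 0
  show ?case by (intro exI[of _ "\<lambda>_. c 0"]) simp
next
  case (Suc n)
  note r = Suc.prems
  obtain w where w: "\<And>j. j \<le> n \<Longrightarrow> c (Suc j) * (r (Suc j) / r 1) = (\<Sum>k\<le>n. w k * coef n (shift r) a k j)"
    using Suc.IH[OF exps_shift[OF r], of "\<lambda>j. c (Suc j) * (r (Suc j) / r 1)"] by blast
  \<comment> \<open>\<open>w\<close> expands the derivative of the given combination with respect to
    \<open>t powr r 1\<close>. Multiplied by the gaps it yields the increments of the weights
    \<open>W\<close>, and \<open>w0\<close> adjusts the constant coefficient.\<close>
  define w0 where "w0 = c 0 - (\<Sum>i\<le>n. w i * gap n r a i * tl_coef n r a (Suc i) 0)"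
  define W where "W k = w0 + (\<Sum>i<k. w i * gap n r a i)" for k
  have W: "(\<Sum>k\<le>Suc n. W k * coef (Suc n) r a k j) =
     w0 * of_bool (j = 0) + (\<Sum>i\<le>n. w i * gap n r a i * tl_coef n r a (Suc i) j)" for j
    unfolding coef_abel by (simp add: W_def)
  have "c j = (\<Sum>k\<le>Suc n. W k * coef (Suc n) r a k j)" if "j \<le> Suc n" for j
  proof (cases j)
    case 0
    then show ?thesis unfolding W by (simp add: w0_def)
  next
    case (Suc i)
    have "(\<Sum>l\<le>n. w l * gap n r a l * tl_coef n r a (Suc l) (Suc i)) =
       (\<Sum>l\<le>n. r 1 / r (Suc i) * (w l * coef n (shift r) a l i))"
    proof (intro sum.cong refl)
      fix l assume "l \<in> {..n}"
      then have "gap n r a l \<noteq> 0" using gap_pos[OF r assms(2,3), of l n] by simp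
      then show "w l * gap n r a l * tl_coef n r a (Suc l) (Suc i) =
        r 1 / r (Suc i) * (w l * coef n (shift r) a l i)"
        by (simp add: tail_coef_Suc_Suc flip: bint_def)
    qed
    also have "\<dots> = r 1 / r (Suc i) * (c (Suc i) * (r (Suc i) / r 1))"
      using w[of i] that Suc by (simp only: sum_distrib_left[symmetric] Suc_le_mono)
    finally show ?thesis unfolding W Suc using exps_pos_Suc[OF r, of i] exps_pos_Suc[OF r, of 0] by simp
  qed
  then show ?case by blast
qed

text \<open>Forward substitution. It may stop at \<open>K\<close> because in the uniqueness proof a
  zero of multiplicity \<open>k\<close> supplies just the first \<open>k\<close> equations;
  independence takes \<open>K = Suc n\<close>.\<close>

lemma triangular_zero:
  fixes A :: "nat \<Rightarrow> nat \<Rightarrow> real"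
  assumes "\<And>m. m < K \<Longrightarrow> (\<Sum>j\<le>n. w j * A m j) = 0"
    and "\<And>m j. m < j \<Longrightarrow> j \<le> n \<Longrightarrow> A m j = 0" and "\<And>j. j \<le> n \<Longrightarrow> A j j \<noteq> 0"
    and "K \<le> Suc n" and "j < K"
  shows "w j = 0"
  using \<open>j < K\<close>
proof (induction j rule: less_induct)
  case (less j)
  have "(\<Sum>i\<le>n. w i * A j i) = (\<Sum>i\<in>{j}. w i * A j i)"
    using less assms(2,4) by (intro sum.mono_neutral_right) (auto simp: not_less_iff_gr_or_eq neq_iff)
  then show ?case using assms(1)[OF less.prems] assms(3)[of j] assms(4) less.prems by simp
qed

lemma higher_deriv_bern_lincomb:
  assumes "\<And>t. 0 < t \<Longrightarrow> f t = (\<Sum>k\<le>n. w k * bern n r a k t)" and x: "0 < x"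
  shows "(deriv ^^ m) f x = (\<Sum>k\<le>n. w k * (deriv ^^ m) (bern n r a k) x)"
proof -
  have "f t = (\<Sum>j\<le>n. (\<Sum>k\<le>n. w k * coef n r a k j) * t powr r j)" if "0 < t" for t
    using assms(1)[OF that] unfolding bern_lincomb .
  from higher_deriv_powr_sum[of f, OF this x] have "(deriv ^^ m) f x =
     (\<Sum>j\<le>n. (\<Sum>k\<le>n. w k * coef n r a k j) * x powr r j * poly (ffact_poly m) (r j)) / x ^ m" .
  also have "\<dots> = (\<Sum>k\<le>n. w k * ((\<Sum>j\<le>n. coef n r a k j * x powr r j * poly (ffact_poly m) (r j)) / x ^ m))"
    unfolding sum_distrib_left sum_distrib_right sum_divide_distrib
    by (subst sum.swap) (simp add: mult.assoc)
  finally show ?thesis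
    unfolding higher_deriv_powr_sum[of "bern n r a _", OF bern_def x] .
qed

lemma bern_lincomb_order_left:
  assumes r: "exps r" "0 < a" "a < 1"
    and f: "\<And>t. 0 < t \<Longrightarrow> f t = (\<Sum>k\<le>n. w k * bern n r a k t)"
    and "\<And>m. m < K \<Longrightarrow> (deriv ^^ m) f a = 0" "K \<le> Suc n" "j < K"
  shows "w j = 0"
proof (rule triangular_zero[where A = "\<lambda>m k. (deriv ^^ m) (bern n r a k) a"])
  show "(\<Sum>k\<le>n. w k * (deriv ^^ m) (bern n r a k) a) = 0" if "m < K" for m
    using higher_deriv_bern_lincomb[of f, OF f r(2)] assms(5)[OF that] by simp
qed (use bern_zero_mult_left[OF r] assms in \<open>auto simp: zero_mult_def\<close>)

lemma bern_lincomb_order_right: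
  assumes r: "exps r" "0 < a" "a < 1"
    and f: "\<And>t. 0 < t \<Longrightarrow> f t = (\<Sum>k\<le>n. w k * bern n r a k t)"
    and "\<And>m. m < K \<Longrightarrow> (deriv ^^ m) f 1 = 0" "K \<le> Suc n" "j < K"
  shows "w (n - j) = 0"
proof (rule triangular_zero[where A = "\<lambda>m k. (deriv ^^ m) (bern n r a (n - k)) 1" and w = "\<lambda>j. w (n - j)"])
  show "(\<Sum>k\<le>n. w (n - k) * (deriv ^^ m) (bern n r a (n - k)) 1) = 0" if "m < K" for m
  proof -
    have "(\<Sum>k\<le>n. w (n - k) * (deriv ^^ m) (bern n r a (n - k)) 1) =
      (\<Sum>k\<le>n. w k * (deriv ^^ m) (bern n r a k) 1)"
      by (rule sum.reindex_bij_witness[of _ "\<lambda>k. n - k" "\<lambda>k. n - k"]) auto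
    then show ?thesis
      using higher_deriv_bern_lincomb[of f, OF f zero_less_one] assms(5)[OF that] by simp
  qed
  show "(deriv ^^ m) (bern n r a (n - k)) 1 = 0" if "m < k" "k \<le> n" for m k
    using bern_zero_mult_right[OF r, of "n - k" n] that by (simp add: zero_mult_def)
  show "(deriv ^^ k) (bern n r a (n - k)) 1 \<noteq> 0" if "k \<le> n" for k
    using bern_zero_mult_right[OF r, of "n - k" n] that by (simp add: zero_mult_def)
qed (use assms in auto)

lemma bern_independent:
  assumes r: "exps r" "0 < a" "a < 1"
    and "\<And>t. 0 < t \<Longrightarrow> (\<Sum>k\<le>n. w k * bern n r a k t) = 0" and "k \<le> n"
  shows "w k = 0"
proof (rule bern_lincomb_order_left[OF r, where f = "\<lambda>_. 0" and K = "Suc n"])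
  show "(deriv ^^ m) (\<lambda>_. 0) a = (0::real)" for m
  proof -
    have "(deriv ^^ m) (\<lambda>_. 0) = (\<lambda>_. 0 :: real)" by (induction m) auto
    then show ?thesis by simp
  qed
qed (use assms in auto)

lemma bern_is_CB_basis:
  assumes "exps r" "0 < a" "a < 1"
  shows "is_CB_basis r n a 1 (bern n r a)"
  unfolding is_CB_basis_def in_E_def
proof (intro conjI allI impI)
  show "\<exists>c. \<forall>t>0. bern n r a k t = (\<Sum>i\<le>n. c i * t powr r i)" for k
    by (auto simp: bern_def)
  show "c k = 0" if "\<forall>t>0. (\<Sum>k\<le>n. c k * bern n r a k t) = 0" "k \<le> n" for c k
    using bern_independent[OF assms, where n = n and w = c and k = k] that by blast
qed (use bern_zero_mult_left[OF assms] bern_zero_mult_right[OF assms] bern_sum[OF assms(1)] in auto)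

text \<open>Expand \<open>B k\<close> in the constructed basis: its zero at \<open>a\<close> removes
  the indices below \<open>k\<close>, its zero at 1 those above. So \<open>B k\<close> is a multiple
  of \<open>bern n r a k\<close>, and the partition of unity together with independence makes the
  factor 1.\<close>

lemma CB_basis_unique:
  assumes r: "exps r" "0 < a" "a < 1" and B: "is_CB_basis r n a 1 B"
    and "k \<le> n" "0 < t"
  shows "B k t = bern n r a k t"
proof -
  have "\<exists>c. \<forall>t>0. B k t = c * bern n r a k t" if k: "k \<le> n" for k
  proof -
    obtain c where c: "\<And>t. 0 < t \<Longrightarrow> B k t = (\<Sum>i\<le>n. c i * t powr r i)"
      using B k unfolding is_CB_basis_def in_E_def by blast
    obtain w where w: "\<And>j. j \<le> n \<Longrightarrow> c j = (\<Sum>k\<le>n. w k * coef n r a k j)"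
      using coef_span[OF r(1) less_imp_le[OF r(2)] r(3)] by blast
    have f: "B k t = (\<Sum>i\<le>n. w i * bern n r a i t)" if "0 < t" for t
      unfolding bern_lincomb using c[OF that] w by simp
    have z: "zero_mult (B k) a k" "zero_mult (B k) 1 (n - k)"
      using B k unfolding is_CB_basis_def by auto
    have low: "w j = 0" if "j < k" for j
      by (rule bern_lincomb_order_left[OF r f _ _ that]) (use z k in \<open>auto simp: zero_mult_def\<close>)
    have high: "w j = 0" if "k < j" "j \<le> n" for j
      using bern_lincomb_order_right[OF r, where f = "B k" and n = n and w = w and K = "n - k" and j = "n - j"] f z that
      by (auto simp: zero_mult_def)
    have "B k t = w k * bern n r a k t" if "0 < t" for t
    proof -
      have "B k t = (\<Sum>i\<in>{k}. w i * bern n r a i t)"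
        unfolding f[OF that] using k low high by (intro sum.mono_neutral_right) (auto simp: neq_iff)
      then show ?thesis by simp
    qed
    then show ?thesis by blast
  qed
  then obtain c where c: "\<And>k t. k \<le> n \<Longrightarrow> 0 < t \<Longrightarrow> B k t = c k * bern n r a k t" by metis
  have "c k - 1 = 0"
  proof (rule bern_independent[OF r])
    fix t :: real assume t: "0 < t"
    have "(\<Sum>k\<le>n. B k t) = 1" using B t unfolding is_CB_basis_def by blast
    then have "(\<Sum>k\<le>n. c k * bern n r a k t) = 1" using c t by simp
    then show "(\<Sum>k\<le>n. (c k - 1) * bern n r a k t) = 0"
      using bern_sum[OF r(1) t] by (simp add: left_diff_distrib sum_subtractf)
  qed fact
  then show ?thesis using c[OF assms(5,6)] by simp
qed

lemma control_points_eq: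
  assumes r: "exps r" "0 < a" "a < 1"
  shows "control_points r (Suc n) a 1 (\<lambda>t. t powr r 1) = map (cpt n r a) [0..<Suc (Suc n)]"
  unfolding control_points_def
proof (rule the_equality)
  let ?es = "map (cpt n r a) [0..<Suc (Suc n)]"
  have "t powr r 1 = (\<Sum>i\<le>Suc n. bern (Suc n) r a i t * ?es ! i)" if "0 < t" for t
    unfolding cpt_reproduces[OF r(1) less_imp_le[OF r(2)] r(3) that, of n, symmetric]
    by (intro sum.cong refl) (simp add: nth_append less_Suc_eq_le mult.commute del: upt_Suc)
  then show "length ?es = Suc (Suc n) \<and>
    (\<exists>B. is_CB_basis r (Suc n) a 1 B \<and> (\<forall>t>0. t powr r 1 = (\<Sum>i\<le>Suc n. B i t * ?es ! i)))"
    using bern_is_CB_basis[OF r] by (intro conjI exI[of _ "bern (Suc n) r a"]) auto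
next
  fix es :: "real list"
  assume "length es = Suc (Suc n) \<and>
    (\<exists>B. is_CB_basis r (Suc n) a 1 B \<and> (\<forall>t>0. t powr r 1 = (\<Sum>i\<le>Suc n. B i t * es ! i)))"
  then obtain B where es: "length es = Suc (Suc n)" and B: "is_CB_basis r (Suc n) a 1 B"
    and eq: "\<And>t. 0 < t \<Longrightarrow> t powr r 1 = (\<Sum>i\<le>Suc n. B i t * es ! i)" by blast
  have "es ! k - cpt n r a k = 0" if "k \<le> Suc n" for k
  proof (rule bern_independent[OF r _ that])
    fix t :: real assume t: "0 < t"
    have "(\<Sum>i\<le>Suc n. es ! i * bern (Suc n) r a i t) = t powr r 1"
      unfolding eq[OF t] using CB_basis_unique[OF r B _ t]
      by (intro sum.cong) (auto simp: mult.commute)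
    then show "(\<Sum>k\<le>Suc n. (es ! k - cpt n r a k) * bern (Suc n) r a k t) = 0"
      using cpt_reproduces[OF r(1) less_imp_le[OF r(2)] r(3) t, of n]
      by (simp only: left_diff_distrib sum_subtractf)
  qed
  then show "es = map (cpt n r a) [0..<Suc (Suc n)]"
    using es by (intro nth_equalityI) (auto simp del: upt_Suc)
qed

section \<open>Density\<close>

lemma exp_neg_le_quadratic:
  fixes x :: real
  assumes "0 \<le> x"
  shows "exp (- x) \<le> 1 - x + x\<^sup>2 / 2"
proof -
  have "1 - 0 + 0\<^sup>2 / 2 - exp (- 0) \<le> 1 - x + x\<^sup>2 / 2 - exp (- x)"
  proof (rule DERIV_nonneg_imp_nondecreasing[OF assms])
    fix y :: real
    have "((\<lambda>x. 1 - x + x\<^sup>2 / 2 - exp (- x)) has_real_derivative (- 1 + y + exp (- y))) (at y)"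
      by (auto intro!: derivative_eq_intros)
    moreover have "0 \<le> - 1 + y + exp (- y)" using exp_ge_add_one_self[of "- y"] by simp
    ultimately show "\<exists>d. ((\<lambda>x. 1 - x + x\<^sup>2 / 2 - exp (- x)) has_real_derivative d) (at y) \<and> 0 \<le> d"
      by blast
  qed
  then show ?thesis by simp
qed

lemma one_minus_powr_le:
  fixes z p :: real
  assumes "0 \<le> z" "z \<le> 1" "0 \<le> p"
  shows "(1 - z) powr p \<le> 1 - p * z + (p * z)\<^sup>2 / 2"
proof -
  have "(1 - z) powr p \<le> exp (- z) powr p"
    using assms exp_ge_add_one_self[of "- z"] by (intro powr_mono2) auto
  also have "\<dots> = exp (- (p * z))" by (simp add: powr_def)
  also have "\<dots> \<le> 1 - p * z + (p * z)\<^sup>2 / 2" using assms by (intro exp_neg_le_quadratic) simp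
  finally show ?thesis .
qed

lemma cpt_mono:
  assumes "exps r" "0 \<le> a" "a < 1" "i \<le> j"
  shows "cpt n r a i \<le> cpt n r a j"
  unfolding cpt_def using gap_pos[OF assms(1-3)] assms(4)
  by (intro diff_left_mono sum_mono2) (auto simp: less_imp_le)

lemma cpt_zero_bounds:
  assumes "exps r" "k \<le> Suc n"
  shows "0 \<le> cpt n r 0 k" "cpt n r 0 k \<le> 1"
  using cpt_bounds[OF assms(1) order_refl zero_less_one assms(2)] by simp_all

lemma cpt_zero_step:
  assumes "exps r" "k \<le> n"
  shows "cpt n r 0 k = (1 - r 1 / r (Suc k)) * cpt n r 0 (Suc k)"
proof -
  have "cpt n r 0 k = (\<Prod>i=Suc k..Suc n. 1 - r 1 / r i)" using assms by (intro cpt_zero) auto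
  also have "\<dots> = (1 - r 1 / r (Suc k)) * (\<Prod>i=Suc (Suc k)..Suc n. 1 - r 1 / r i)"
    using assms by (intro prod.atLeast_Suc_atMost) auto
  also have "(\<Prod>i=Suc (Suc k)..Suc n. 1 - r 1 / r i) = cpt n r 0 (Suc k)"
    using assms by (intro cpt_zero[symmetric]) auto
  finally show ?thesis .
qed

text \<open>Downward induction on \<open>k\<close>. With \<open>z = r 1 / r (Suc k)\<close>,
  replacing \<open>(1 - z) powr p\<close> by \<open>1 - p * z\<close> costs at most
  \<open>p\<^sup>2 / 2 * z\<^sup>2\<close>. Since \<open>z\<close> times control point
  \<open>k + 1\<close> is the step between consecutive control points, these costs accumulate to
  \<open>1 - cpt n r 0 k\<close> times a factor that decreases in \<open>k\<close>.\<close>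

lemma cpt_zero_powr_le:
  assumes r: "exps r" and k: "1 \<le> k" "k \<le> Suc n"
  defines "p \<equiv> r 2 / r 1"
  shows "cpt n r 0 k powr p - (\<Prod>i=Suc k..Suc n. 1 - r 2 / r i) \<le>
    p\<^sup>2 / 2 * (r 1 / r (Suc k)) * (1 - cpt n r 0 k)"
  using k(2,1)
proof (induction k rule: inc_induct)
  case base
  show ?case by simp
next
  case (step k)
  have r1: "0 < r 1" and p: "1 < p"
    using exps_pos[OF r, of 1] exps_less[OF r, of 1 2] by (simp_all add: p_def)
  define z where "z = r 1 / r (Suc k)"
  define v where "v = 1 - r 2 / r (Suc k)"
  define C where "C = p\<^sup>2 / 2"
  let ?e = "cpt n r 0 (Suc k)" and ?th = "\<Prod>i=Suc (Suc k)..Suc n. 1 - r 2 / r i"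
  have k: "k \<le> n" using step by simp
  have rk: "0 < r (Suc k)" using exps_pos[OF r] by simp
  have "1 < Suc k" "Suc k = 2 \<or> 2 < Suc k" using step by auto
  then have "r 1 \<le> r (Suc k)" "r 2 \<le> r (Suc k)" "r (Suc k) \<le> r (Suc (Suc k))"
    using exps_less[OF r, of 1 "Suc k"] exps_less[OF r, of 2 "Suc k"] exps_less[OF r, of "Suc k" "Suc (Suc k)"]
    by (auto simp: numeral_2_eq_2)
  then have z: "0 < z" "z \<le> 1" and v: "0 \<le> v" "v \<le> 1" and z': "r 1 / r (Suc (Suc k)) \<le> z"
    using r1 rk exps_pos[OF r, of 2] by (auto simp: z_def v_def field_simps intro: frac_le)
  have pz: "v = 1 - p * z" using r1 by (simp add: v_def z_def p_def)
  have e: "0 \<le> ?e" "?e \<le> 1" using cpt_zero_bounds[OF r] k by auto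
  have ep: "0 \<le> ?e powr p" "?e powr p \<le> ?e"
    using powr_mono'[of 1 p ?e] e p by (simp_all)
  have C: "0 \<le> C" by (simp add: C_def)
  have IH: "?e powr p - ?th \<le> C * z * (1 - ?e)"
  proof -
    have "?e powr p - ?th \<le> C * (r 1 / r (Suc (Suc k))) * (1 - ?e)"
      using step by (simp add: C_def)
    also have "\<dots> \<le> C * z * (1 - ?e)" using z' C e by (intro mult_right_mono mult_left_mono) auto
    finally show ?thesis .
  qed
  have u: "(1 - z) powr p - v \<le> C * z * z"
  proof -
    have "(1 - z) powr p - v \<le> (p * z)\<^sup>2 / 2"
      using one_minus_powr_le[of z p] z p unfolding pz by simp
    then show ?thesis by (simp add: C_def power2_eq_square mult_ac)
  qed
  have "cpt n r 0 k powr p = (1 - z) powr p * ?e powr p"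
    unfolding cpt_zero_step[OF r k] z_def[symmetric] using z e by (simp add: powr_mult)
  moreover have "(\<Prod>i=Suc k..Suc n. 1 - r 2 / r i) = v * ?th"
    unfolding v_def using k by (intro prod.atLeast_Suc_atMost) auto
  ultimately have "cpt n r 0 k powr p - (\<Prod>i=Suc k..Suc n. 1 - r 2 / r i) =
      v * (?e powr p - ?th) + ((1 - z) powr p - v) * ?e powr p"
    by (simp add: algebra_simps)
  also have "\<dots> \<le> 1 * (C * z * (1 - ?e)) + C * z * z * ?e"
  proof (intro add_mono)
    have "v * (?e powr p - ?th) \<le> v * (C * z * (1 - ?e))" using IH v by (intro mult_left_mono)
    also have "\<dots> \<le> 1 * (C * z * (1 - ?e))" using v C z e by (intro mult_right_mono) auto
    finally show "v * (?e powr p - ?th) \<le> 1 * (C * z * (1 - ?e))" .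
    have "((1 - z) powr p - v) * ?e powr p \<le> C * z * z * ?e powr p"
      using u ep by (intro mult_right_mono)
    also have "\<dots> \<le> C * z * z * ?e" using ep C z by (intro mult_left_mono) auto
    finally show "((1 - z) powr p - v) * ?e powr p \<le> C * z * z * ?e" .
  qed
  also have "\<dots> = C * z * (1 - cpt n r 0 k)"
    unfolding cpt_zero_step[OF r k] z_def[symmetric] by (simp add: algebra_simps)
  finally show ?case by (simp only: C_def z_def)
qed

text \<open>For fixed \<open>k\<close> the product is at most the exponential of
  \<open>- r 1\<close> times a partial sum of the divergent series from index \<open>k\<close>
  on.\<close>

lemma cpt_zero_tendsto_0:
  assumes r: "exps r" and div: "\<not> summable (\<lambda>i. 1 / r (Suc i))" and e: "0 < e"
  shows "\<exists>N. \<forall>n\<ge>N. cpt n r 0 k < e"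
proof -
  let ?f = "\<lambda>i. 1 / r (Suc i)"
  have f: "0 < ?f i" for i using exps_pos_Suc[OF r] by simp
  have r1: "0 < r 1" using exps_pos[OF r, of 1] by simp
  obtain N where N: "(\<Sum>i<k. ?f i) - ln e / r 1 < (\<Sum>i<N. ?f i)"
    using div summableI_nonneg_bounded[of ?f "(\<Sum>i<k. ?f i) - ln e / r 1"] f
    by (meson less_imp_le not_le)
  show ?thesis
  proof (intro exI allI impI)
    fix n assume n: "max N k \<le> n"
    have "cpt n r 0 k = (\<Prod>i=Suc k..Suc n. 1 - r 1 / r i)" using n by (intro cpt_zero r) auto
    also have "\<dots> \<le> (\<Prod>i=Suc k..Suc n. exp (- (r 1 / r i)))"
    proof (intro prod_mono conjI)
      fix i assume i: "i \<in> {Suc k..Suc n}"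
      then have "r 1 \<le> r i" "0 < r i"
        using exps_less[OF r, of 1 i] exps_pos[OF r, of i] by (cases "i = 1"; simp)+
      then show "0 \<le> 1 - r 1 / r i" by simp
      show "1 - r 1 / r i \<le> exp (- (r 1 / r i))" using exp_ge_add_one_self[of "- (r 1 / r i)"] by simp
    qed
    also have "\<dots> = exp (- r 1 * (\<Sum>i=Suc k..Suc n. 1 / r i))"
      by (simp add: exp_sum sum_distrib_left del: sum.cl_ivl_Suc prod.cl_ivl_Suc)
    also have "(\<Sum>i=Suc k..Suc n. 1 / r i) = (\<Sum>i=k..n. ?f i)"
      by (rule sum.shift_bounds_cl_Suc_ivl)
    also have "\<dots> = (\<Sum>i<Suc n. ?f i) - (\<Sum>i<k. ?f i)"
    proof -
      have "{..<Suc n} - {..<k} = {k..n}" by auto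
      then show ?thesis using n sum_diff[of "{..<Suc n}" "{..<k}" ?f] by auto
    qed
    also have "exp (- r 1 * ((\<Sum>i<Suc n. ?f i) - (\<Sum>i<k. ?f i))) < e"
    proof -
      have "(\<Sum>i<N. ?f i) \<le> (\<Sum>i<Suc n. ?f i)"
        using n f by (intro sum_mono2) (auto simp: less_imp_le)
      then have "- ln e / r 1 < (\<Sum>i<Suc n. ?f i) - (\<Sum>i<k. ?f i)" using N by simp
      then have "- ln e < ((\<Sum>i<Suc n. ?f i) - (\<Sum>i<k. ?f i)) * r 1" using r1 by (simp only: divide_less_eq if_True)
      then have "- r 1 * ((\<Sum>i<Suc n. ?f i) - (\<Sum>i<k. ?f i)) < ln e" by (simp add: mult.commute)
      then have "exp (- r 1 * ((\<Sum>i<Suc n. ?f i) - (\<Sum>i<k. ?f i))) < exp (ln e)" by (simp only: exp_less_cancel_iff)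
      then show ?thesis using e by simp
    qed
    finally show "cpt n r 0 k < e" .
  qed
qed

text \<open>Split at a \<open>K\<close> beyond which \<open>r\<close> is large. Above
  \<open>K\<close> the bound of \<open>cpt_zero_powr_le\<close> is small uniformly in
  \<open>n\<close>; up to \<open>K\<close> the control points themselves are small for large
  \<open>n\<close>, by monotonicity in the index and divergence of the series.\<close>

lemma defect_tendsto_0:
  assumes r: "exps r" and lim: "filterlim r at_top sequentially"
    and div: "\<not> summable (\<lambda>i. 1 / r (Suc i))" and e: "0 < e"
  shows "\<exists>N. \<forall>n\<ge>N. \<forall>k\<le>Suc n.
    cpt n r 0 k powr (r 2 / r 1) - (\<Prod>i=Suc k..Suc n. 1 - r 2 / r i) \<le> e"
proof -
  define p where "p = r 2 / r 1"
  have r1: "0 < r 1" and p: "1 < p"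
    using exps_pos[OF r, of 1] exps_less[OF r, of 1 2] by (simp_all add: p_def)
  have "\<forall>\<^sub>F k in sequentially. p\<^sup>2 / 2 * r 1 / e \<le> r k" using lim by (simp add: filterlim_at_top)
  then obtain K where K: "\<And>k. K \<le> k \<Longrightarrow> p\<^sup>2 / 2 * r 1 / e \<le> r k"
    unfolding eventually_sequentially by blast
  obtain N where N: "\<And>n. N \<le> n \<Longrightarrow> cpt n r 0 (Suc K) < e"
    using cpt_zero_tendsto_0[OF r div e] by blast
  show ?thesis unfolding p_def[symmetric]
  proof (intro exI allI impI)
    fix n k assume n: "max N (max K 1) \<le> n" and k: "k \<le> Suc n"
    have b: "0 \<le> cpt n r 0 k" "cpt n r 0 k \<le> 1" using cpt_zero_bounds[OF r k] by auto
    let ?th = "\<Prod>i=Suc k..Suc n. 1 - r 2 / r i"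
    show "cpt n r 0 k powr p - ?th \<le> e"
    proof (cases "k \<le> K")
      case True
      have "0 \<le> ?th"
      proof (cases "k \<le> 1")
        case True
        \<comment> \<open>The factor with \<open>i = 2\<close> vanishes; it occurs because
          \<open>n\<close> is at least 1.\<close>
        have "?th = 0"
          by (rule prod_zero) (use True n exps_pos[OF r, of 2] in \<open>auto intro!: bexI[of _ 2]\<close>)
        then show ?thesis by simp
      next
        case False
        show ?thesis
        proof (intro prod_nonneg ballI)
          fix i assume "i \<in> {Suc k..Suc n}"
          then have "2 < i" using False by simp
          then have "r 2 < r i" "0 < r i" using exps_less[OF r] exps_pos[OF r, of i] by auto
          then show "0 \<le> 1 - r 2 / r i" by simp
        qed
      qed
      moreover have "cpt n r 0 k powr p \<le> cpt n r 0 k"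
        using powr_mono'[of 1 p "cpt n r 0 k"] b p by simp
      moreover have "cpt n r 0 k \<le> cpt n r 0 (Suc K)"
        using True by (intro cpt_mono r) auto
      ultimately show ?thesis using N[of n] n by simp
    next
      case False
      have rk: "0 < r (Suc k)" "p\<^sup>2 / 2 * r 1 / e \<le> r (Suc k)"
        using exps_pos[OF r, of "Suc k"] K[of "Suc k"] False by auto
      have "cpt n r 0 k powr p - ?th \<le> p\<^sup>2 / 2 * (r 1 / r (Suc k)) * (1 - cpt n r 0 k)"
        unfolding p_def using cpt_zero_powr_le[OF r _ k] False by simp
      also have "\<dots> \<le> p\<^sup>2 / 2 * (r 1 / r (Suc k)) * 1"
        using b r1 rk by (intro mult_left_mono) auto
      also have "\<dots> \<le> e" using rk e by (simp add: field_simps)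
      finally show ?thesis .
    qed
  qed
qed

text \<open>\<open>cpt_near\<close> finds a control point near \<open>x powr r 1\<close>, with a
  bound independent of \<open>x\<close>; uniform continuity of the root on
  \<open>{a powr r 1..1}\<close> turns this into nearness to \<open>x\<close>.\<close>

lemma control_points_dense:
  assumes r: "exps r" and lim: "filterlim r at_top sequentially"
    and div: "\<not> summable (\<lambda>i. 1 / r (Suc i))" and a: "0 < a" "a < 1" and e: "0 < e"
  shows "\<exists>N. \<forall>n\<ge>N. \<forall>x\<in>{a..1}. \<exists>k\<le>Suc n. \<bar>x - cpt n r a k powr (1 / r 1)\<bar> < e"
proof -
  have r1: "0 < r 1" and r12: "r 1 < r 2" using exps_pos[OF r, of 1] exps_less[OF r, of 1 2] by auto
  let ?h = "\<lambda>u::real. u powr (1 / r 1)"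
  have "uniformly_continuous_on {a powr r 1..1} ?h"
  proof (rule compact_uniformly_continuous)
    show "continuous_on {a powr r 1..1} ?h"
      using a powr_gt_zero[of a "r 1"] by (intro continuous_intros) force+
  qed simp
  then obtain d where d: "0 < d"
    "\<And>u v. u \<in> {a powr r 1..1} \<Longrightarrow> v \<in> {a powr r 1..1} \<Longrightarrow> dist v u < d \<Longrightarrow> dist (?h v) (?h u) < e"
    unfolding uniformly_continuous_on_def using e by metis
  define c where "c = (r 2 / r 1) * (r 2 / r 1 - 1) * a powr r 2 / 2"
  have c: "0 < c" using r1 r12 a by (simp add: c_def)
  obtain N where N: "\<And>n k. N \<le> n \<Longrightarrow> k \<le> Suc n \<Longrightarrow>
     cpt n r 0 k powr (r 2 / r 1) - (\<Prod>i=Suc k..Suc n. 1 - r 2 / r i) \<le> c * (d / 2)\<^sup>2"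
    using defect_tendsto_0[OF r lim div mult_pos_pos[OF c zero_less_power[OF half_gt_zero[OF d(1)]]]]
    by blast
  show ?thesis
  proof (rule exI[of _ "max N 1"], intro allI impI ballI)
    fix n x assume n: "max N 1 \<le> n" and x: "x \<in> {a..1}"
    obtain k where k: "k \<le> Suc n" "c * (cpt n r a k - x powr r 1)\<^sup>2 \<le> c * (d / 2)\<^sup>2"
    proof (rule cpt_near[OF r a, of x n "c * (d / 2)\<^sup>2"])
      show "(\<Prod>i=Suc k..Suc n. 1 - r 1 / r i) powr (r 2 / r 1) - (\<Prod>i=Suc k..Suc n. 1 - r 2 / r i)
        \<le> c * (d / 2)\<^sup>2" if "k \<le> Suc n" for k
        using N[of n k] that n cpt_zero[OF r that] by simp
    qed (use x n that c_def in auto)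
    have "\<bar>cpt n r a k - x powr r 1\<bar> \<le> d / 2"
      using k(2) c d(1) abs_le_square_iff[of "cpt n r a k - x powr r 1" "d / 2"] by simp
    then have "dist (cpt n r a k) (x powr r 1) < d" using d(1) by (simp add: dist_real_def)
    moreover have "x powr r 1 \<in> {a powr r 1..1}"
      using x a r1 powr_mono2[of "r 1" x 1] by (auto intro: powr_mono2)
    moreover have "cpt n r a k \<in> {a powr r 1..1}"
      using cpt_bounds[OF r less_imp_le[OF a(1)] a(2) k(1)] by simp
    ultimately have "dist (?h (cpt n r a k)) (?h (x powr r 1)) < e" by (intro d(2))
    moreover have "?h (x powr r 1) = x" using x a r1 by (simp add: powr_powr)
    ultimately show "\<exists>k\<le>Suc n. \<bar>x - cpt n r a k powr (1 / r 1)\<bar> < e"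
      using k(1) by (intro exI[of _ k]) (simp add: dist_real_def abs_minus_commute)
  qed
qed

theorem theorem8:
  fixes r :: "nat \<Rightarrow> real" and a :: real
  assumes "r 0 = 0" and "strict_mono r"
    and "filterlim r at_top sequentially"
    and "\<not> summable (\<lambda>i. 1 / r (Suc i))"
    and "0 < a" and "a < 1"
  defines "D \<equiv> \<lambda>m. {(control_points r m a 1 (\<lambda>t. t powr r 1) ! i) powr (1 / r 1) | i. i \<le> m}"
  shows "(\<lambda>m. SUP x\<in>{a..1}. Min ((\<lambda>d. \<bar>x - d\<bar>) ` D m)) \<longlonglongrightarrow> 0"
proof (rule LIMSEQ_I)
  fix e :: real assume e: "0 < e"
  have r: "exps r" using assms by (simp add: exps_def)
  let ?M = "\<lambda>m x. Min ((\<lambda>d. \<bar>x - d\<bar>) ` D m)"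
  \<comment> \<open>Half of \<open>e\<close> keeps the final inequality strict after passing to the
    supremum.\<close>
  obtain N where N: "\<And>n x. N \<le> n \<Longrightarrow> x \<in> {a..1} \<Longrightarrow>
      \<exists>k\<le>Suc n. \<bar>x - cpt n r a k powr (1 / r 1)\<bar> < e / 2"
    using control_points_dense[OF r assms(3-6) half_gt_zero[OF e]] by blast
  have "norm ((SUP x\<in>{a..1}. ?M m x) - 0) < e" if m: "Suc N \<le> m" for m
  proof -
    obtain n where n: "m = Suc n" "N \<le> n" using m by (cases m) auto
    have D: "D m = (\<lambda>k. cpt n r a k powr (1 / r 1)) ` {..Suc n}"
    proof -
      have "map (cpt n r a) [0..<Suc (Suc n)] ! i = cpt n r a i" if "i \<le> Suc n" for i
        using that by (simp add: less_Suc_eq_le del: upt_Suc)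
      then show ?thesis
        unfolding D_def n(1) control_points_eq[OF r assms(5,6)] by force
    qed
    have fin: "finite (D m)" "D m \<noteq> {}" unfolding D by auto
    have le: "?M m x \<le> e / 2" if x: "x \<in> {a..1}" for x
    proof -
      obtain k where k: "k \<le> Suc n" "\<bar>x - cpt n r a k powr (1 / r 1)\<bar> < e / 2"
        using N[OF n(2) x] by blast
      then have "?M m x \<le> \<bar>x - cpt n r a k powr (1 / r 1)\<bar>"
        using fin by (intro Min_le) (auto simp: D)
      then show ?thesis using k by simp
    qed
    have ge: "0 \<le> ?M m x" for x
      using fin by (subst Min_ge_iff) auto
    have "(SUP x\<in>{a..1}. ?M m x) \<le> e / 2"
      using le assms(6) by (intro cSUP_least) auto
    moreover have "0 \<le> (SUP x\<in>{a..1}. ?M m x)"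
      using le ge assms(6) by (intro cSUP_upper2[of _ _ a] bdd_aboveI2[where M = "e / 2"]) auto
    ultimately show ?thesis using e by simp
  qed
  then show "\<exists>no. \<forall>m\<ge>no. norm ((SUP x\<in>{a..1}. ?M m x) - 0) < e" by blast
qed

end
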